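(* Let $\check u\in H^{(s_t,s_s)}(\check{\mathcal{K}})$, let $\alpha=(\alpha_t,\alpha_s)$ with $\alpha_t=\alpha_0$, $\alpha_s=(\alpha_1,\alpha_2)$, $\alpha_i\ge0$ integers, and let $\widehat u=\check u\circ F_{\mathcal{K}}$. Then (for every such $\alpha$ for which the respective norms are defined) $$\|\check D^\alpha\check u\|^2_{\check{\mathcal{K}}}=\left(\tfrac{2}{\Delta t}\right)^{2\alpha_0-1}\|\widehat D^\alpha\widehat u\|^2_{\widehat{\mathcal{K}}},$$ $$\|\check D^\alpha\check u\|^2_{\partial\check{\mathcal{K}}_0}=\left(\tfrac{2}{\Delta t}\right)^{2\alpha_0}\|\widehat D^\alpha\widehat u\|^2_{\partial\widehat{\mathcal{K}}_0},$$ $$\|\check D^\alpha\check u\|^2_{\partial\check{\mathcal{K}}_j}=\left(\tfrac{2}{\Delta t}\right)^{2\alpha_0-1}\|\widehat D^\alpha\widehat u\|^2_{\partial\widehat{\mathcal{K}}_j},\qquad j=1,2,3.$$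
   Context: $\widehat K$ is the reference triangle with vertices $(0,0),(1,0),(0,1)$, and $\widehat{\mathcal{K}}=(-1,1)\times\widehat K$ is the reference prism with coordinates $(\widehat x_0,\widehat x_1,\widehat x_2)$. For $\Delta t=t_{n+1}-t_n>0$, the intermediate prism is $\check{\mathcal{K}}=(t_n,t_{n+1})\times\widehat K=F_{\mathcal{K}}(\widehat{\mathcal{K}})$, where $F_{\mathcal{K}}(\widehat x_0,\widehat x_1,\widehat x_2)=(\tfrac{\Delta t}{2}\widehat x_0+b_0,\widehat x_1,\widehat x_2)$ and $b_0=(t_n+t_{n+1})/2$. The boundary pieces are: $\partial\widehat{\mathcal{K}}_0$, the two faces $\widehat x_0=-1$ and $\widehat x_0=1$; $\partial\widehat{\mathcal{K}}_1$, the face $\widehat x_1=0$; $\partial\widehat{\mathcal{K}}_2$, the face $\widehat x_2=0$; $\partial\widehat{\mathcal{K}}_3$, the face $\widehat x_1+\widehat x_2=1$; and $\partial\check{\mathcal{K}}_i=F_{\mathcal{K}}(\partial\widehat{\mathcal{K}}_i)$, $i=0,1,2,3$. $\check D^\alpha=\partial_{\check x_0}^{\alpha_0}\partial_{\check x_1}^{\alpha_1}\partial_{\check x_2}^{\alpha_2}$ and similarly $\widehat D^\alpha$. $\|\cdot\|_D$ is the $L^2(D)$ norm (with surface measure on faces, in the trace sense). $H^{(s_t,s_s)}(D)$ is the space of $v\in L^2(D)$ with $\partial_{x_0}^{\alpha_t}\partial_{x_1}^{\alpha_1}\partial_{x_2}^{\alpha_2}v\in L^2(D)$ for all $\alpha_t\le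 s_t$, $\alpha_1+\alpha_2\le s_s$. *)

theory Defs
  imports "HOL-Analysis.Analysis"
begin

type_synonym pt = "real \<times> real \<times> real"


section \<open>Reference prism, intermediate prism and their boundary pieces\<close>

definition ref_triangle :: "(real \<times> real) set" where
  "ref_triangle = interior (convex hull {(0, 0), (1, 0), (0, 1)})"

definition prism :: "real \<Rightarrow> real \<Rightarrow> pt set" where
  "prism a b = {a<..<b} \<times> ref_triangle"

abbreviation ref_prism :: "pt set" where
  "ref_prism \<equiv> prism (- 1) 1"

definition prism_map :: "real \<Rightarrow> real \<Rightarrow> pt \<Rightarrow> pt" where
  "prism_map tn tn1 = (\<lambda>(x0, x1, x2). ((tn1 - tn) / 2 * x0 + (tn + tn1) / 2, x1, x2))"

lemma prism_map_image:
  assumes "tn < tn1"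
  shows "prism_map tn tn1 ` ref_prism = prism tn tn1"
proof
  have "prism_map tn tn1 (s, y) \<in> prism tn tn1" if "- 1 < s" "s < 1" "y \<in> ref_triangle" for s y
  proof -
    have "0 < (tn1 - tn) * (1 + s)" "0 < (tn1 - tn) * (1 - s)" using assms that by auto
    then show ?thesis
      using that by (cases y) (auto simp: prism_map_def prism_def field_simps)
  qed
  then show "prism_map tn tn1 ` ref_prism \<subseteq> prism tn tn1"
    unfolding prism_def[of "- 1" 1] by (intro image_subsetI) (auto simp del: split_paired_All)
  show "prism tn tn1 \<subseteq> prism_map tn tn1 ` ref_prism"
  proof
    fix x :: pt assume x: "x \<in> prism tn tn1"
    obtain t y where xe: "x = (t, y)" by (cases x)
    have t: "tn < t" "t < tn1" and y: "y \<in> ref_triangle"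
      using x xe by (auto simp: prism_def)
    define s where "s = (2 * t - tn - tn1) / (tn1 - tn)"
    have s: "- 1 < s" "s < 1" using t assms by (auto simp: s_def field_simps)
    have "(tn1 - tn) * s = 2 * t - tn - tn1" using assms by (simp add: s_def)
    then have "x = prism_map tn tn1 (s, y)"
      by (cases y) (simp add: xe prism_map_def field_simps)
    then show "x \<in> prism_map tn tn1 ` ref_prism"
      using s y by (auto simp: prism_def)
  qed
qed

text \<open>The pieces are indexed by \<open>i = 0, 1, 2, 3\<close>; piece \<open>0\<close> consists of two faces.\<close>

definition ref_boundary :: "nat \<Rightarrow> pt set" where
  "ref_boundary i =
     [{(x0, x1, x2) \<in> closure ref_prism. x0 = - 1 \<or> x0 = 1},
      {(x0, x1, x2) \<in> closure ref_prism. x1 = 0},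
      {(x0, x1, x2) \<in> closure ref_prism. x2 = 0},
      {(x0, x1, x2) \<in> closure ref_prism. x1 + x2 = 1}] ! i"

definition prism_boundary :: "real \<Rightarrow> real \<Rightarrow> nat \<Rightarrow> pt set" where
  "prism_boundary tn tn1 i = prism_map tn tn1 ` ref_boundary i"


section \<open>Surface measure\<close>

text \<open>
  Surface measure on the union of the parallel planes \<open>p + span {v, w}\<close>, \<open>p \<in> P\<close>, which have to
  be pairwise distinct. The density is the square root of the Gram determinant, i.e. the area of
  the parallelogram spanned by \<open>v\<close> and \<open>w\<close>.
\<close>

definition planes_measure :: "pt set \<Rightarrow> pt \<Rightarrow> pt \<Rightarrow> pt measure" where
  "planes_measure P v w =
     density (distr (count_space P \<Otimes>\<^sub>M (lborel :: (real \<times> real) measure)) borel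
                    (\<lambda>(p, s, r). p + s *\<^sub>R v + r *\<^sub>R w))
             (\<lambda>_. ennreal (sqrt ((v \<bullet> v) * (w \<bullet> w) - (v \<bullet> w)\<^sup>2)))"

text \<open>
  Surface measure on a subset \<open>\<Gamma>\<close> of the planes that carry the \<open>i\<close>-th boundary piece. These are
  the planes \<open>x\<^sub>1 = 0\<close>, \<open>x\<^sub>2 = 0\<close>, \<open>x\<^sub>1 + x\<^sub>2 = 1\<close> for \<open>i = 1, 2, 3\<close>; for \<open>i = 0\<close> they are the planes
  \<open>x\<^sub>0 = c\<close> that meet \<open>\<Gamma>\<close>.
\<close>

definition surface_measure :: "nat \<Rightarrow> pt set \<Rightarrow> pt measure" where
  "surface_measure i \<Gamma> = restrict_space
     ([planes_measure ((\<lambda>c. (c, 0, 0)) ` fst ` \<Gamma>) (0, 1, 0) (0, 0, 1),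
       planes_measure {(0, 0, 0)} (1, 0, 0) (0, 0, 1),
       planes_measure {(0, 0, 0)} (1, 0, 0) (0, 1, 0),
       planes_measure {(0, 0, 1)} (1, 0, 0) (0, 1, - 1)] ! i) \<Gamma>"


section \<open>Square integrable functions\<close>

definition L2 :: "'a measure \<Rightarrow> ('a \<Rightarrow> real) set" where
  "L2 M = {f \<in> borel_measurable M. integrable M (\<lambda>x. (f x)\<^sup>2)}"

definition L2_norm :: "'a measure \<Rightarrow> ('a \<Rightarrow> real) \<Rightarrow> real" where
  "L2_norm M f = sqrt (\<integral>x. (f x)\<^sup>2 \<partial>M)"


section \<open>Classical derivatives and test functions\<close>

definition pderivative :: "pt \<Rightarrow> (pt \<Rightarrow> real) \<Rightarrow> (pt \<Rightarrow> real)" where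
  "pderivative e f = (\<lambda>x. deriv (\<lambda>h. f (x + h *\<^sub>R e)) 0)"

definition partial_D :: "nat \<Rightarrow> nat \<Rightarrow> nat \<Rightarrow> (pt \<Rightarrow> real) \<Rightarrow> (pt \<Rightarrow> real)" where
  "partial_D a0 a1 a2 f =
     (pderivative (1, 0, 0) ^^ a0) ((pderivative (0, 1, 0) ^^ a1) ((pderivative (0, 0, 1) ^^ a2) f))"

text \<open>
  \<open>C\<^sup>\<infinity>\<close> on the whole space: every iterated partial derivative, taken in any order, is
  (Frechet) differentiable everywhere.
\<close>

definition smooth :: "(pt \<Rightarrow> real) \<Rightarrow> bool" where
  "smooth f \<longleftrightarrow> (\<forall>es. set es \<subseteq> Basis \<longrightarrow> (\<forall>x. fold pderivative es f differentiable (at x)))"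

definition test_function :: "pt set \<Rightarrow> (pt \<Rightarrow> real) \<Rightarrow> bool" where
  "test_function D \<phi> \<longleftrightarrow>
     smooth \<phi> \<and> compact (closure {x. \<phi> x \<noteq> 0}) \<and> closure {x. \<phi> x \<noteq> 0} \<subseteq> D"


section \<open>Weak derivatives and anisotropic Sobolev spaces\<close>

definition is_weak_D ::
    "pt set \<Rightarrow> nat \<Rightarrow> nat \<Rightarrow> nat \<Rightarrow> (pt \<Rightarrow> real) \<Rightarrow> (pt \<Rightarrow> real) \<Rightarrow> bool" where
  "is_weak_D D a0 a1 a2 u w \<longleftrightarrow>
     u \<in> L2 (lebesgue_on D) \<and> w \<in> L2 (lebesgue_on D) \<and>
     (\<forall>\<phi>. test_function D \<phi> \<longrightarrow>
        (\<integral>x. u x * partial_D a0 a1 a2 \<phi> x \<partial>lebesgue_on D)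
          = (- 1) ^ (a0 + a1 + a2) * (\<integral>x. w x * \<phi> x \<partial>lebesgue_on D))"

definition weak_D_exists :: "pt set \<Rightarrow> nat \<Rightarrow> nat \<Rightarrow> nat \<Rightarrow> (pt \<Rightarrow> real) \<Rightarrow> bool" where
  "weak_D_exists D a0 a1 a2 u \<longleftrightarrow> (\<exists>w. is_weak_D D a0 a1 a2 u w)"

text \<open>For open \<open>D\<close> the weak derivative is determined up to a null set.\<close>

definition weak_D :: "pt set \<Rightarrow> nat \<Rightarrow> nat \<Rightarrow> nat \<Rightarrow> (pt \<Rightarrow> real) \<Rightarrow> (pt \<Rightarrow> real)" where
  "weak_D D a0 a1 a2 u = (SOME w. is_weak_D D a0 a1 a2 u w)"

definition sobolev :: "nat \<Rightarrow> nat \<Rightarrow> pt set \<Rightarrow> (pt \<Rightarrow> real) set" where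
  "sobolev st ss D = {v \<in> L2 (lebesgue_on D).
     \<forall>a0 a1 a2. a0 \<le> st \<longrightarrow> a1 + a2 \<le> ss \<longrightarrow> weak_D_exists D a0 a1 a2 v}"

lemma sobolev_weak_D_exists:
  "v \<in> sobolev st ss D \<Longrightarrow> a0 \<le> st \<Longrightarrow> a1 + a2 \<le> ss \<Longrightarrow> weak_D_exists D a0 a1 a2 v"
  by (simp add: sobolev_def)


section \<open>Traces\<close>

text \<open>
  \<open>g\<close> is the trace of \<open>v \<in> H\<^bsup>(rt,rs)\<^esup>(D)\<close> on the set carrying the surface measure \<open>\<sigma>\<close>: it is the
  \<open>L\<^sup>2(\<sigma>)\<close> limit of the restrictions of functions that are smooth up to the boundary of \<open>D\<close> and
  converge to \<open>v\<close> in \<open>H\<^bsup>(rt,rs)\<^esup>(D)\<close>.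
\<close>

definition is_trace ::
    "nat \<Rightarrow> nat \<Rightarrow> pt set \<Rightarrow> pt measure \<Rightarrow> (pt \<Rightarrow> real) \<Rightarrow> (pt \<Rightarrow> real) \<Rightarrow> bool" where
  "is_trace rt rs D \<sigma> v g \<longleftrightarrow>
     v \<in> sobolev rt rs D \<and> g \<in> L2 \<sigma> \<and>
     (\<exists>\<phi> :: nat \<Rightarrow> pt \<Rightarrow> real. (\<forall>n. smooth (\<phi> n)) \<and>
        (\<forall>a0 a1 a2. a0 \<le> rt \<longrightarrow> a1 + a2 \<le> rs \<longrightarrow>
           (\<lambda>n. L2_norm (lebesgue_on D) (\<lambda>x. partial_D a0 a1 a2 (\<phi> n) x - weak_D D a0 a1 a2 v x))
             \<longlonglongrightarrow> 0) \<and>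
        (\<lambda>n. L2_norm \<sigma> (\<lambda>x. \<phi> n x - g x)) \<longlonglongrightarrow> 0)"

text \<open>
  Only derivatives transversal to a face are needed for a trace on it, so traces are taken in
  \<open>H\<^bsup>(1,0)\<^esup>(D)\<close> on the two faces \<open>x\<^sub>0 = const\<close> (\<open>i = 0\<close>) and in \<open>H\<^bsup>(0,1)\<^esup>(D)\<close> on the other faces.
  Both spaces contain the isotropic space \<open>H\<^sup>1(D)\<close>, on which this is the usual trace.
\<close>

definition is_face_trace ::
    "nat \<Rightarrow> pt set \<Rightarrow> pt set \<Rightarrow> (pt \<Rightarrow> real) \<Rightarrow> (pt \<Rightarrow> real) \<Rightarrow> bool" where
  "is_face_trace i D \<Gamma> v g \<longleftrightarrow>
     (if i = 0 then is_trace 1 0 D (surface_measure i \<Gamma>) v g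
      else is_trace 0 1 D (surface_measure i \<Gamma>) v g)"

definition face_trace_exists :: "nat \<Rightarrow> pt set \<Rightarrow> pt set \<Rightarrow> (pt \<Rightarrow> real) \<Rightarrow> bool" where
  "face_trace_exists i D \<Gamma> v \<longleftrightarrow> (\<exists>g. is_face_trace i D \<Gamma> v g)"

definition face_trace :: "nat \<Rightarrow> pt set \<Rightarrow> pt set \<Rightarrow> (pt \<Rightarrow> real) \<Rightarrow> (pt \<Rightarrow> real)" where
  "face_trace i D \<Gamma> v = (SOME g. is_face_trace i D \<Gamma> v g)"

definition volume_norm :: "pt set \<Rightarrow> (pt \<Rightarrow> real) \<Rightarrow> real" where
  "volume_norm D v = L2_norm (lebesgue_on D) v"

definition face_norm :: "nat \<Rightarrow> pt set \<Rightarrow> pt set \<Rightarrow> (pt \<Rightarrow> real) \<Rightarrow> real" where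
  "face_norm i D \<Gamma> v = L2_norm (surface_measure i \<Gamma>) (face_trace i D \<Gamma> v)"

end

theory Submission
  imports Defs
begin

text \<open>
  The affine map \<open>T = prism_map tn tn1\<close> stretches the first coordinate by \<open>c = (tn1 - tn) / 2\<close>. Lebesgue
  measure and the measure on the faces parallel to the first axis scale by \<open>c\<close>, the measure on the two
  faces orthogonal to it is preserved, and \<open>c ^ a0\<close> times the weak derivative of \<open>u\<close>, composed with \<open>T\<close>, is
  a weak derivative of \<open>u \<circ> T\<close>; traces are transported in the same way.

  As weak derivatives and traces are arbitrarily chosen representatives, the identities also need
  their uniqueness up to null sets. For weak derivatives this is the fundamental lemma of the calculus
  of variations, with smooth bumps that converge to indicators of boxes. For traces it is a trace
  inequality: integrating the derivative of \<open>d\<^sup>2\<close> along the chord of the prism through a point of a face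
  bounds \<open>d\<^sup>2\<close> there, weighted with the length of the chord, which vanishes only on a null set.
\<close>

section \<open>Smooth functions\<close>

text \<open>Objects are transported in one direction only: the representative chosen on the
  stretched prism, composed with the stretch, is an admissible object on the reference prism. Hence
  uniqueness of traces is a question about the reference prism alone. The trace inequality is shaped
  by the anisotropic spaces. On the two faces \<open>x0 = const\<close> only the derivative in
  \<open>x0\<close> is controlled, on the other faces only those in \<open>x1\<close> and
  \<open>x2\<close>. Each face therefore gets one coordinate direction whose derivative is
  available, and the estimate becomes one-dimensional. Without a weight its constant would behave
  like the reciprocal of the chord length, which is unbounded near the edges of the lateral
  faces.\<close>

lemma Basis_pt: "(Basis :: pt set) = {(1, 0, 0), (0, 1, 0), (0, 0, 1)}"
  by (auto simp: Basis_prod_def zero_prod_def)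

text \<open>\<open>smooth\<close> speaks of all finite sequences of partial derivatives, for which
  closed formulas are awkward. A class of differentiable functions that is closed under partial
  derivatives contains only smooth functions, so a smoothness proof reduces to the choice of such a
  class.\<close>

lemma smooth_coinduct:
  assumes "P f"
    and diff: "\<And>g x. P g \<Longrightarrow> g differentiable (at x)"
    and step: "\<And>g e. P g \<Longrightarrow> e \<in> Basis \<Longrightarrow> P (pderivative e g)"
  shows "smooth f"
proof -
  have "P (fold pderivative es f)" if "set es \<subseteq> Basis" "P f" for es f
    using that by (induction es arbitrary: f) (auto intro: step)
  then show ?thesis
    using assms(1) diff unfolding smooth_def by blast
qed

lemma smooth_differentiable: "smooth f \<Longrightarrow> f differentiable (at x)"
  by (drule smooth_def[THEN iffD1, rule_format, of _ "[]"]) simp_all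

lemma smooth_pderivative:
  assumes "smooth f" "e \<in> Basis" shows "smooth (pderivative e f)"
proof -
  have "fold pderivative es (pderivative e f) differentiable (at x)" if "set es \<subseteq> Basis" for es x
    using assms(1)[unfolded smooth_def, rule_format, of "e # es" x] assms(2) that by simp
  then show ?thesis unfolding smooth_def by blast
qed

lemma smooth_pderivative_funpow: "smooth f \<Longrightarrow> e \<in> Basis \<Longrightarrow> smooth ((pderivative e ^^ n) f)"
  by (induction n) (auto intro: smooth_pderivative)

lemma smooth_partial_D: "smooth f \<Longrightarrow> smooth (partial_D a0 a1 a2 f)"
  unfolding partial_D_def by (intro smooth_pderivative_funpow) (auto simp: Basis_pt)

lemma smooth_continuous_on: "smooth f \<Longrightarrow> continuous_on S f"
  by (meson continuous_at_imp_continuous_on differentiable_imp_continuous_within smooth_differentiable)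

lemma smooth_borel_measurable: "smooth f \<Longrightarrow> f \<in> borel_measurable borel"
  by (intro borel_measurable_continuous_onI smooth_continuous_on)

lemma has_real_derivative_along_line:
  assumes "f differentiable (at (x + t *\<^sub>R e))"
  shows "((\<lambda>h. f (x + h *\<^sub>R e)) has_real_derivative pderivative e f (x + t *\<^sub>R e)) (at t)"
proof -
  obtain f' where f': "(f has_derivative f') (at (x + t *\<^sub>R e))"
    using assms unfolding differentiable_def by blast
  \<comment> \<open>The chain rule is applied to two parametrizations: to the line through
    \<open>x\<close> at parameter \<open>t\<close>, and to the line restarted at
    \<open>x + t *\<^sub>R e\<close> at parameter 0, the form in which \<open>pderivative\<close> is
    defined.\<close>
  have *: "((\<lambda>h. f (x + h *\<^sub>R e)) has_real_derivative f' e) (at t)" if "x + t *\<^sub>R e = z + s *\<^sub>R e"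
    and f': "(f has_derivative f') (at (x + t *\<^sub>R e))" for x z t s
  proof -
    have lin: "linear f'"
      using f' has_derivative_linear by blast
    have "((\<lambda>h. f (x + h *\<^sub>R e)) has_derivative (\<lambda>h. f' (h *\<^sub>R e))) (at t)"
      by (rule has_derivative_compose[where f = "\<lambda>h. x + h *\<^sub>R e" and g = f, OF _ f'])
         (auto intro!: derivative_eq_intros)
    moreover have "(\<lambda>h. f' (h *\<^sub>R e)) = (*) (f' e)"
      using lin by (simp add: fun_eq_iff linear_cmul)
    ultimately show ?thesis by (simp add: has_field_derivative_def)
  qed
  have "pderivative e f (x + t *\<^sub>R e) = f' e"
    unfolding pderivative_def
    by (rule DERIV_imp_deriv) (rule *[of "x + t *\<^sub>R e" 0 "x + t *\<^sub>R e" 0], use f' in auto)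
  with *[OF refl f'] show ?thesis by simp
qed

lemma pderivative_eqI:
  assumes "((\<lambda>h. f (x + h *\<^sub>R e)) has_real_derivative d) (at 0)"
  shows "pderivative e f x = d"
  unfolding pderivative_def using assms by (rule DERIV_imp_deriv)

lemma has_real_derivative_pderivative:
  "f differentiable (at x) \<Longrightarrow> ((\<lambda>h. f (x + h *\<^sub>R e)) has_real_derivative pderivative e f x) (at 0)"
  using has_real_derivative_along_line[of f x 0 e] by simp

lemma pderivative_diff:
  assumes "\<And>x. f differentiable (at x)" "\<And>x. g differentiable (at x)"
  shows "pderivative e (\<lambda>x. f x - g x) = (\<lambda>x. pderivative e f x - pderivative e g x)"
  by (intro ext pderivative_eqI DERIV_diff has_real_derivative_pderivative assms)

lemma smooth_diff:
  assumes "smooth f" "smooth g" shows "smooth (\<lambda>x. f x - g x)"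
proof (rule smooth_coinduct[where P = "\<lambda>h. \<exists>f g. smooth f \<and> smooth g \<and> h = (\<lambda>x. f x - g x)"])
  show "\<exists>f' g'. smooth f' \<and> smooth g' \<and> (\<lambda>x. f x - g x) = (\<lambda>x. f' x - g' x)"
    using assms by blast
next
  fix h x assume "\<exists>f g. smooth f \<and> smooth g \<and> h = (\<lambda>x. f x - g x)"
  then show "h differentiable (at x)"
    by (elim exE conjE) (simp add: differentiable_diff smooth_differentiable)
next
  fix h and e :: pt assume h: "\<exists>f g. smooth f \<and> smooth g \<and> h = (\<lambda>x. f x - g x)" and e: "e \<in> Basis"
  then obtain f g where "smooth f" "smooth g" "h = (\<lambda>x. f x - g x)" by blast
  then show "\<exists>f g. smooth f \<and> smooth g \<and> pderivative e h = (\<lambda>x. f x - g x)"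
    using e by (intro exI[of _ "pderivative e f"] exI[of _ "pderivative e g"])
      (simp add: pderivative_diff smooth_differentiable smooth_pderivative)
qed

section \<open>Stretching the first coordinate\<close>

text \<open>Arbitrary \<open>c\<close> and \<open>b\<close> make the family closed under inversion
  for nonzero \<open>c\<close>, and \<open>b = 0\<close> gives the linear part, which serves as the
  derivative.\<close>

definition stretch :: "real \<Rightarrow> real \<Rightarrow> pt \<Rightarrow> pt" where
  "stretch c b = (\<lambda>(x0, y). (c * x0 + b, y))"

lemma stretch_simp [simp]: "stretch c b (x0, y) = (c * x0 + b, y)"
  by (simp add: stretch_def)

lemma prism_map_eq_stretch: "prism_map tn tn1 = stretch ((tn1 - tn) / 2) ((tn + tn1) / 2)"
  by (auto simp: prism_map_def stretch_def)

lemma stretch_inverse: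
  assumes "c \<noteq> 0"
  shows "stretch c b (stretch (1 / c) (- b / c) x) = x" "stretch (1 / c) (- b / c) (stretch c b x) = x"
proof -
  have "c * (1 / c * t + - b / c) + b = t" "1 / c * (c * t + b) + - b / c = t" for t
    using assms by (simp_all add: field_simps)
  then show "stretch c b (stretch (1 / c) (- b / c) x) = x"
    "stretch (1 / c) (- b / c) (stretch c b x) = x"
    by (cases x; simp only: stretch_simp)+
qed

lemma bij_stretch:
  assumes "c \<noteq> 0" shows "bij (stretch c b)"
  by (rule o_bij[of "stretch (1 / c) (- b / c)"];
      unfold o_def id_def; rule ext; rule stretch_inverse[OF assms])

lemma stretch_has_derivative: "(stretch c b has_derivative stretch c 0) (at x)"
proof -
  have "stretch c b = (\<lambda>x. (c * fst x + b, snd x))" for b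
    by (auto simp: stretch_def)
  then show ?thesis by (auto intro!: derivative_eq_intros)
qed

lemma continuous_on_stretch: "continuous_on S (stretch c b)"
  by (meson continuous_at_imp_continuous_on has_derivative_continuous stretch_has_derivative)

lemma stretch_add_Basis:
  assumes "e \<in> Basis"
  shows "stretch c b (x + h *\<^sub>R e) = stretch c b x + (h * (if e = (1, 0, 0) then c else 1)) *\<^sub>R e"
  using assms by (cases x) (auto simp: Basis_pt algebra_simps)

text \<open>The scalar \<open>m\<close> collects the factors that the chain rule produces, so the
  functions \<open>m * f (stretch c b x)\<close> with smooth \<open>f\<close> form a class closed
  under partial derivatives.\<close>

lemma pderivative_stretch:
  assumes "\<And>x. f differentiable (at x)" "e \<in> Basis"
  shows "pderivative e (\<lambda>x. m * f (stretch c b x))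
     = (\<lambda>x. m * (if e = (1, 0, 0) then c else 1) * pderivative e f (stretch c b x))"
proof (rule ext, rule pderivative_eqI)
  fix x
  let ?k = "if e = (1, 0, 0) then c else (1::real)"
  have "((\<lambda>h. f (stretch c b x + (h * ?k) *\<^sub>R e)) has_real_derivative
     pderivative e f (stretch c b x) * ?k) (at 0)"
    by (rule DERIV_chain2[where f = "\<lambda>h. f (stretch c b x + h *\<^sub>R e)"])
       (auto intro!: derivative_eq_intros has_real_derivative_pderivative assms)
  then have "((\<lambda>h. m * f (stretch c b (x + h *\<^sub>R e))) has_real_derivative
     m * (pderivative e f (stretch c b x) * ?k)) (at 0)"
    unfolding stretch_add_Basis[OF assms(2)] by (rule DERIV_cmult)
  then show "((\<lambda>h. m * f (stretch c b (x + h *\<^sub>R e))) has_real_derivative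
     m * ?k * pderivative e f (stretch c b x)) (at 0)"
    by (simp add: ac_simps)
qed

lemma differentiable_stretch:
  fixes f :: "pt \<Rightarrow> real"
  assumes "\<And>x. f differentiable (at x)"
  shows "(\<lambda>x. m * f (stretch c b x)) differentiable (at (x::pt))"
proof -
  obtain f' where "(f has_derivative f') (at (stretch c b x))"
    using assms differentiable_def by blast
  from has_derivative_compose[OF stretch_has_derivative this]
  have "(\<lambda>x. f (stretch c b x)) differentiable (at x)"
    unfolding differentiable_def by blast
  then show ?thesis by (rule differentiable_mult[OF differentiable_const])
qed

lemma smooth_stretch:
  assumes "smooth f" shows "smooth (\<lambda>x. m * f (stretch c b x))"
proof (rule smooth_coinduct[where P = "\<lambda>h. \<exists>m f. smooth f \<and> h = (\<lambda>x. m * f (stretch c b x))"])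
  show "\<exists>m' f'. smooth f' \<and> (\<lambda>x. m * f (stretch c b x)) = (\<lambda>x. m' * f' (stretch c b x))"
    using assms by blast
next
  fix h x assume "\<exists>m f. smooth f \<and> h = (\<lambda>x. m * f (stretch c b x))"
  then show "h differentiable (at x)"
    by (elim exE conjE) (simp only: differentiable_stretch smooth_differentiable)
next
  fix h and e :: pt assume h: "\<exists>m f. smooth f \<and> h = (\<lambda>x. m * f (stretch c b x))" and e: "e \<in> Basis"
  then obtain m f where "smooth f" "h = (\<lambda>x. m * f (stretch c b x))" by blast
  then show "\<exists>m f. smooth f \<and> pderivative e h = (\<lambda>x. m * f (stretch c b x))"
    using e by (intro exI[of _ "m * (if e = (1, 0, 0) then c else 1)"] exI[of _ "pderivative e f"])
      (simp add: pderivative_stretch smooth_differentiable smooth_pderivative)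
qed

lemma pderivative_funpow_stretch:
  assumes "smooth f" "e \<in> Basis"
  shows "(pderivative e ^^ n) (\<lambda>x. m * f (stretch c b x))
     = (\<lambda>x. m * (if e = (1, 0, 0) then c else 1) ^ n * (pderivative e ^^ n) f (stretch c b x))"
  using assms by (induction n)
     (auto simp: pderivative_stretch smooth_differentiable smooth_pderivative_funpow)

lemma partial_D_stretch:
  assumes "smooth f"
  shows "partial_D a0 a1 a2 (\<lambda>x. m * f (stretch c b x))
     = (\<lambda>x. m * c ^ a0 * partial_D a0 a1 a2 f (stretch c b x))"
  using assms
  by (simp add: partial_D_def Basis_pt pderivative_funpow_stretch smooth_pderivative_funpow)

section \<open>Bump functions\<close>

definition smooth1 :: "(real \<Rightarrow> real) \<Rightarrow> bool" where
  "smooth1 g \<longleftrightarrow> (\<forall>n x. (deriv ^^ n) g differentiable (at x))"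

lemma smooth1_coinduct:
  assumes "P f"
    and diff: "\<And>g x. P g \<Longrightarrow> g differentiable (at x)"
    and step: "\<And>g. P g \<Longrightarrow> P (deriv g)"
  shows "smooth1 f"
proof -
  have "P ((deriv ^^ n) f)" for n
    using assms(1) by (induction n) (auto intro: step)
  then show ?thesis
    using diff unfolding smooth1_def by blast
qed

lemma smooth1_differentiable: "smooth1 g \<Longrightarrow> g differentiable (at x)"
  unfolding smooth1_def by (drule spec[of _ 0]) simp

lemma smooth1_deriv: "smooth1 g \<Longrightarrow> smooth1 (deriv g)"
  unfolding smooth1_def by (metis comp_apply funpow_Suc_right)

lemma smooth1_has_derivative: "smooth1 g \<Longrightarrow> (g has_real_derivative deriv g x) (at x)"
  using DERIV_deriv_iff_real_differentiable smooth1_differentiable by blast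

text \<open>
  Products of smooth functions are not closed under \<open>deriv\<close>, but their finite sums are, which makes
  them an invariant for \<open>smooth1_coinduct\<close>.
\<close>

inductive product_sum :: "(real \<Rightarrow> real) \<Rightarrow> bool" where
  product: "smooth1 f \<Longrightarrow> smooth1 g \<Longrightarrow> product_sum (\<lambda>x. f x * g x)"
| sum: "product_sum f \<Longrightarrow> product_sum g \<Longrightarrow> product_sum (\<lambda>x. f x + g x)"

lemma product_sum_deriv:
  "product_sum f \<Longrightarrow> (\<forall>x. f differentiable (at x)) \<and> product_sum (deriv f)"
proof (induction rule: product_sum.induct)
  case (product f g)
  have "deriv (\<lambda>x. f x * g x) = (\<lambda>x. deriv f x * g x + f x * deriv g x)"
    by (rule ext, rule DERIV_imp_deriv)
       (use product in \<open>auto intro!: derivative_eq_intros smooth1_has_derivative\<close>)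
  then show ?case
    using product
    by (auto intro!: product_sum.intros smooth1_deriv differentiable_mult simp: smooth1_differentiable)
next
  case (sum f g)
  have "deriv (\<lambda>x. f x + g x) = (\<lambda>x. deriv f x + deriv g x)"
    using sum by (auto intro!: ext DERIV_imp_deriv DERIV_add simp: DERIV_deriv_iff_real_differentiable)
  then show ?case using sum by (auto intro!: product_sum.intros derivative_intros)
qed

lemma smooth1_mult:
  assumes "smooth1 f" "smooth1 g" shows "smooth1 (\<lambda>x. f x * g x)"
  by (rule smooth1_coinduct[where P = product_sum])
     (use assms product_sum_deriv in \<open>auto intro: product_sum.intros\<close>)

lemma smooth1_affine:
  assumes "smooth1 f" shows "smooth1 (\<lambda>x. f (m * x + b))"
proof -
  have d: "((\<lambda>x. k * g (m * x + b)) has_real_derivative (k * m) * deriv g (m * x + b)) (at x)"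
    if "smooth1 g" for k g x
    by (auto intro!: derivative_eq_intros DERIV_chain2[where f = g] smooth1_has_derivative that)
  show ?thesis
  proof (rule smooth1_coinduct[where P = "\<lambda>h. \<exists>k g. smooth1 g \<and> h = (\<lambda>x. k * g (m * x + b))"])
    show "\<exists>k g. smooth1 g \<and> (\<lambda>x. f (m * x + b)) = (\<lambda>x. k * g (m * x + b))"
      using assms by (intro exI[of _ 1] exI[of _ f]) auto
    show "h differentiable (at x)"
      if "\<exists>k g. smooth1 g \<and> h = (\<lambda>x. k * g (m * x + b))" for h x
      using that d real_differentiable_def by blast
    show "\<exists>k g. smooth1 g \<and> deriv h = (\<lambda>x. k * g (m * x + b))"
      if h: "\<exists>k g. smooth1 g \<and> h = (\<lambda>x. k * g (m * x + b))" for h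
    proof -
      obtain k g where g: "smooth1 g" "h = (\<lambda>x. k * g (m * x + b))" using h by blast
      have "deriv h = (\<lambda>x. (k * m) * deriv g (m * x + b))"
        unfolding g(2) by (rule ext, rule DERIV_imp_deriv, rule d[OF g(1)])
      then show ?thesis using smooth1_deriv[OF g(1)] by blast
    qed
  qed
qed

text \<open>The classical function \<open>exp (- 1 / t)\<close>, extended by 0, is
  \<open>flat 1\<close>. Its derivatives carry polynomials in \<open>1 / t\<close> as factors;
  admitting every such polynomial yields a family closed under \<open>deriv\<close>, so one proof of
  differentiability settles all orders.\<close>

definition flat :: "real poly \<Rightarrow> real \<Rightarrow> real" where
  "flat p t = (if t > 0 then poly p (1 / t) * exp (- (1 / t)) else 0)"

lemma poly_exp_tendsto_0: "((\<lambda>x::real. poly p x * exp (- x)) \<longlongrightarrow> 0) at_top"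
proof -
  have "((\<lambda>x::real. \<Sum>i\<le>degree p. coeff p i * (x ^ i / exp x)) \<longlongrightarrow> (\<Sum>i\<le>degree p. coeff p i * 0)) at_top"
    by (intro tendsto_sum tendsto_mult tendsto_const tendsto_power_div_exp_0)
  then show ?thesis
    by (simp add: poly_altdef sum_divide_distrib exp_minus field_simps)
qed

lemma flat_has_derivative:
  "(flat p has_real_derivative flat ([:0, 0, 1:] * (p - pderiv p)) t) (at t)"
proof -
  consider "t < 0" | "t = 0" | "t > 0" by linarith
  then show ?thesis
  proof cases
    case 1
    have "((\<lambda>_. 0) has_real_derivative 0) (at t)" by simp
    then have "(flat p has_real_derivative 0) (at t)"
      by (rule has_field_derivative_transform_within_open[of _ _ _ "{..<0}"])
         (use 1 in \<open>auto simp: flat_def\<close>)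
    then show ?thesis using 1 by (simp add: flat_def)
  next
    case 2
    \<comment> \<open>The polynomial \<open>[:0, 1:]\<close>, evaluated at \<open>inverse h\<close>,
      supplies the denominator \<open>h\<close> of the difference quotient at 0.\<close>
    have "((\<lambda>h. poly ([:0, 1:] * p) (inverse h) * exp (- inverse h)) \<longlongrightarrow> 0) (at_right 0)"
      using filterlim_compose[OF poly_exp_tendsto_0 filterlim_inverse_at_top_right] .
    moreover have "eventually (\<lambda>h. poly ([:0, 1:] * p) (inverse h) * exp (- inverse h) =
        (flat p (0 + h) - flat p 0) / h) (at_right 0)"
      unfolding eventually_at_right_field
      by (intro exI[of _ 1]) (auto simp: flat_def field_simps)
    ultimately have "((\<lambda>h. (flat p (0 + h) - flat p 0) / h) \<longlongrightarrow> 0) (at_right 0)"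
      by (rule Lim_transform_eventually)
    moreover have "((\<lambda>h. (flat p (0 + h) - flat p 0) / h) \<longlongrightarrow> 0) (at_left 0)"
      by (rule Lim_transform_eventually[OF tendsto_const])
         (auto simp: flat_def eventually_at_left_field intro!: exI[of _ "-1"])
    ultimately show ?thesis
      unfolding 2 DERIV_def by (subst filterlim_at_split) (auto simp: flat_def)
  next
    case 3
    have "((\<lambda>t. poly p (1 / t) * exp (- (1 / t))) has_real_derivative
        flat ([:0, 0, 1:] * (p - pderiv p)) t) (at t)"
      using 3 by (auto intro!: derivative_eq_intros DERIV_chain2[OF poly_DERIV]
          simp: flat_def field_simps power2_eq_square)
    then show ?thesis
      by (rule has_field_derivative_transform_within_open[of _ _ _ "{0<..}"])
         (use 3 in \<open>auto simp: flat_def\<close>)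
  qed
qed

lemma smooth1_flat: "smooth1 (flat p)"
proof (rule smooth1_coinduct[where P = "\<lambda>h. \<exists>p. h = flat p"])
  show "h differentiable (at x)" if "\<exists>p. h = flat p" for h x
    using that flat_has_derivative real_differentiable_def by blast
  show "\<exists>p. deriv h = flat p" if "\<exists>p. h = flat p" for h
    using that flat_has_derivative DERIV_imp_deriv by (metis ext)
qed auto

section \<open>Products of one-variable functions and smooth bumps on boxes\<close>

definition tensor :: "(real \<Rightarrow> real) \<Rightarrow> (real \<Rightarrow> real) \<Rightarrow> (real \<Rightarrow> real) \<Rightarrow> pt \<Rightarrow> real" where
  "tensor f g h = (\<lambda>(x0, x1, x2). f x0 * g x1 * h x2)"

lemma differentiable_tensor:
  assumes "smooth1 f" "smooth1 g" "smooth1 h"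
  shows "tensor f g h differentiable (at x)"
proof -
  have *: "(\<lambda>x. f (F x)) differentiable (at x)"
    if "smooth1 f" "F differentiable (at x)" for F :: "pt \<Rightarrow> real" and f
    using that smooth1_differentiable differentiable_compose[of f F x UNIV] by blast
  have "tensor f g h = (\<lambda>x. f (fst x) * g (fst (snd x)) * h (snd (snd x)))"
    by (auto simp: tensor_def)
  then show ?thesis
    by (simp only:) (intro differentiable_mult *[OF assms(1)] *[OF assms(2)] *[OF assms(3)]
        bounded_linear_imp_differentiable bounded_linear_fst
        bounded_linear_compose[OF bounded_linear_fst bounded_linear_snd]
        bounded_linear_compose[OF bounded_linear_snd bounded_linear_snd])
qed

lemma pderivative_tensor:
  assumes "smooth1 f" "smooth1 g" "smooth1 h"
  shows "pderivative (1, 0, 0) (tensor f g h) = tensor (deriv f) g h"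
    "pderivative (0, 1, 0) (tensor f g h) = tensor f (deriv g) h"
    "pderivative (0, 0, 1) (tensor f g h) = tensor f g (deriv h)"
proof -
  have *: "((\<lambda>h. F (x + h)) has_real_derivative deriv F x) (at 0)" if "smooth1 F" for F x
    using smooth1_has_derivative[OF that, of x] by (simp add: DERIV_shift[symmetric] add.commute)
  show "pderivative (1, 0, 0) (tensor f g h) = tensor (deriv f) g h"
    "pderivative (0, 1, 0) (tensor f g h) = tensor f (deriv g) h"
    "pderivative (0, 0, 1) (tensor f g h) = tensor f g (deriv h)"
    using assms by (auto intro!: ext pderivative_eqI derivative_eq_intros * simp: tensor_def)
qed

lemma smooth_tensor:
  assumes "smooth1 f" "smooth1 g" "smooth1 h" shows "smooth (tensor f g h)"
proof (rule smooth_coinduct[where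
      P = "\<lambda>F. \<exists>f g h. smooth1 f \<and> smooth1 g \<and> smooth1 h \<and> F = tensor f g h"])
  show "\<exists>f g h. smooth1 f \<and> smooth1 g \<and> smooth1 h \<and> pderivative e F = tensor f g h"
    if "\<exists>f g h. smooth1 f \<and> smooth1 g \<and> smooth1 h \<and> F = tensor f g h" "e \<in> Basis" for F e
    using that unfolding Basis_pt
    by (elim exE conjE insertE emptyE; simp only: pderivative_tensor; blast intro: smooth1_deriv)
qed (use assms in \<open>auto intro: differentiable_tensor\<close>)

text \<open>Scaling the argument of \<open>flat 1\<close> by \<open>n > 0\<close> does not move its
  zero set. All these bumps are thus nonzero exactly on the same open interval, while inside it they
  tend to 1: indicators arise as bounded pointwise limits without any convolution.\<close>

definition interval_bump :: "real \<Rightarrow> real \<Rightarrow> real \<Rightarrow> real \<Rightarrow> real" where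
  "interval_bump n a b t = flat 1 (n * (t - a)) * flat 1 (n * (b - t))"

lemma smooth1_interval_bump: "smooth1 (interval_bump n a b)"
proof -
  have "smooth1 (\<lambda>t. flat 1 (n * t + - n * a) * flat 1 (- n * t + n * b))"
    by (rule smooth1_mult[OF smooth1_affine[OF smooth1_flat] smooth1_affine[OF smooth1_flat]])
  then show ?thesis
    by (simp add: interval_bump_def[abs_def] algebra_simps)
qed

lemma flat_1_bounds: "0 \<le> flat 1 t" "flat 1 t \<le> 1"
  by (auto simp: flat_def)

lemma flat_1_tendsto: "(\<lambda>n. flat 1 (real (Suc n) * t)) \<longlonglongrightarrow> of_bool (t > 0)"
proof (cases "t > 0")
  case True
  have "(\<lambda>n. exp (- (1 / t * inverse (real (Suc n))))) \<longlonglongrightarrow> exp (- (1 / t * 0))"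
    by (intro tendsto_intros LIMSEQ_inverse_real_of_nat)
  moreover have "flat 1 (real (Suc n) * t) = exp (- (1 / t * inverse (real (Suc n))))" for n
    using True by (simp add: flat_def zero_less_mult_iff divide_inverse ac_simps del: of_nat_Suc)
  ultimately show ?thesis using True by (simp del: of_nat_Suc)
next
  case False
  then have "\<not> real (Suc n) * t > 0" for n by (simp add: zero_less_mult_iff)
  then show ?thesis using False by (simp add: flat_def)
qed

lemma interval_bump_bounds: "0 \<le> interval_bump n a b t" "interval_bump n a b t \<le> 1"
  unfolding interval_bump_def by (auto intro!: mult_le_one flat_1_bounds mult_nonneg_nonneg)

lemma interval_bump_tendsto:
  "(\<lambda>n. interval_bump (real (Suc n)) a b t) \<longlonglongrightarrow> of_bool (a < t \<and> t < b)"
  using tendsto_mult[OF flat_1_tendsto[of "t - a"] flat_1_tendsto[of "b - t"]]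
  by (simp add: interval_bump_def of_bool_conj)

lemma interval_bump_nonzero: "n > 0 \<Longrightarrow> interval_bump n a b t \<noteq> 0 \<Longrightarrow> a < t \<and> t < b"
  by (auto simp: interval_bump_def flat_def zero_less_mult_iff split: if_splits)

definition box_bump :: "real \<Rightarrow> pt \<Rightarrow> pt \<Rightarrow> pt \<Rightarrow> real" where
  "box_bump n a b = tensor (interval_bump n (fst a) (fst b))
     (interval_bump n (fst (snd a)) (fst (snd b))) (interval_bump n (snd (snd a)) (snd (snd b)))"

lemma mem_box_pt:
  fixes a b x :: pt
  shows "x \<in> box a b \<longleftrightarrow> (fst a < fst x \<and> fst x < fst b) \<and>
     (fst (snd a) < fst (snd x) \<and> fst (snd x) < fst (snd b)) \<and>
     (snd (snd a) < snd (snd x) \<and> snd (snd x) < snd (snd b))"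
  by (cases a; cases b; cases x) (auto simp: mem_box Basis_pt)

lemma box_bump_bounds: "0 \<le> box_bump n a b x" "box_bump n a b x \<le> 1"
  unfolding box_bump_def tensor_def
  by (cases x; auto intro!: mult_le_one interval_bump_bounds mult_nonneg_nonneg)+

lemma box_bump_tendsto: "(\<lambda>n. box_bump (real (Suc n)) a b x) \<longlonglongrightarrow> indicator (box a b) x"
proof -
  have "indicator (box a b) x = of_bool (fst a < fst x \<and> fst x < fst b) *
     of_bool (fst (snd a) < fst (snd x) \<and> fst (snd x) < fst (snd b)) *
     (of_bool (snd (snd a) < snd (snd x) \<and> snd (snd x) < snd (snd b)) :: real)"
    by (simp add: indicator_def mem_box_pt)
  then show ?thesis
    unfolding box_bump_def tensor_def case_prod_beta
    by (simp only:) (intro tendsto_mult interval_bump_tendsto)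
qed

lemma box_bump_nonzero:
  assumes "n > 0" "box_bump n a b x \<noteq> 0" shows "x \<in> box a b"
  using assms(2) interval_bump_nonzero[OF assms(1)]
  unfolding box_bump_def tensor_def mem_box_pt case_prod_beta by auto

lemma test_function_box_bump:
  assumes "n > 0" "cbox a b \<subseteq> D"
  shows "test_function D (box_bump n a b)"
proof -
  have "{x. box_bump n a b x \<noteq> 0} \<subseteq> box a b"
    using box_bump_nonzero[OF assms(1)] by blast
  then have "closure {x. box_bump n a b x \<noteq> 0} \<subseteq> cbox a b"
    using box_subset_cbox by (intro closure_minimal) auto
  moreover from this have "compact (closure {x. box_bump n a b x \<noteq> 0})"
    by (meson bounded_cbox bounded_subset closed_closure compact_eq_bounded_closed)
  ultimately show ?thesis
    using assms(2) unfolding test_function_def box_bump_def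
    by (auto intro!: smooth_tensor smooth1_interval_bump)
qed

section \<open>Square integrable functions\<close>

lemma L2_borel_measurable: "f \<in> L2 M \<Longrightarrow> f \<in> borel_measurable M"
  by (simp add: L2_def)

lemma L2_integrable_square: "f \<in> L2 M \<Longrightarrow> integrable M (\<lambda>x. (f x)\<^sup>2)"
  by (simp add: L2_def)

lemma L2_cmult: "f \<in> L2 M \<Longrightarrow> (\<lambda>x. m * f x) \<in> L2 M"
  by (auto simp: L2_def power_mult_distrib)

lemma L2_integrable_mult:
  assumes "f \<in> L2 M" "g \<in> L2 M" shows "integrable M (\<lambda>x. f x * g x)"
proof (rule Bochner_Integration.integrable_bound)
  show "integrable M (\<lambda>x. (f x)\<^sup>2 + (g x)\<^sup>2)"
    using assms by (intro Bochner_Integration.integrable_add L2_integrable_square)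
  show "(\<lambda>x. f x * g x) \<in> borel_measurable M"
    using assms by (intro borel_measurable_times L2_borel_measurable)
  have "\<bar>a * b\<bar> \<le> a\<^sup>2 + b\<^sup>2" for a b :: real
  proof -
    have "2 * (\<bar>a\<bar> * \<bar>b\<bar>) \<le> a\<^sup>2 + b\<^sup>2"
      using sum_squares_bound[of "\<bar>a\<bar>" "\<bar>b\<bar>"] by (simp add: mult.assoc)
    then show ?thesis
      using abs_ge_zero[of "a * b"] unfolding abs_mult by linarith
  qed
  then show "AE x in M. norm (f x * g x) \<le> norm ((f x)\<^sup>2 + (g x)\<^sup>2)"
    by (auto simp: order_trans[OF _ abs_ge_self])
qed

lemma L2_diff:
  assumes "f \<in> L2 M" "g \<in> L2 M" shows "(\<lambda>x. f x - g x) \<in> L2 M"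
proof -
  have "integrable M (\<lambda>x. (f x)\<^sup>2 + (g x)\<^sup>2 - 2 * (f x * g x))"
    using assms by (intro Bochner_Integration.integrable_add Bochner_Integration.integrable_diff
        L2_integrable_square integrable_mult_right L2_integrable_mult)
  then show ?thesis
    using assms by (auto simp: L2_def power2_diff algebra_simps)
qed

lemma L2_norm_power2: "(L2_norm M f)\<^sup>2 = (\<integral>x. (f x)\<^sup>2 \<partial>M)"
  unfolding L2_norm_def by (simp add: integral_nonneg_AE)

lemma L2_norm_cmult: "L2_norm M (\<lambda>x. m * f x) = \<bar>m\<bar> * L2_norm M f"
  unfolding L2_norm_def by (simp add: power_mult_distrib real_sqrt_mult)

lemma L2_norm_cong_AE:
  assumes "f \<in> borel_measurable M" "g \<in> borel_measurable M" "AE x in M. f x = g x"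
  shows "L2_norm M f = L2_norm M g"
  unfolding L2_norm_def using assms by (auto intro!: arg_cong[where f = sqrt] integral_cong_AE)

lemma diff_power2_le: "(p - q)\<^sup>2 \<le> 2 * p\<^sup>2 + 2 * q\<^sup>2" for p q :: real
  using zero_le_power2[of "p + q"] by (simp add: power2_eq_square algebra_simps)

text \<open>A squared substitute for the triangle inequality. The factor 2 is harmless because it is
  only used for quantities that tend to 0.\<close>

lemma L2_norm_diff_power2_le:
  assumes "f \<in> L2 M" "g \<in> L2 M"
  shows "(L2_norm M (\<lambda>x. f x - g x))\<^sup>2 \<le> 2 * (L2_norm M f)\<^sup>2 + 2 * (L2_norm M g)\<^sup>2"
proof -
  have "(\<integral>x. (f x - g x)\<^sup>2 \<partial>M) \<le> (\<integral>x. 2 * (f x)\<^sup>2 + 2 * (g x)\<^sup>2 \<partial>M)"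
  proof (rule integral_mono)
    show "integrable M (\<lambda>x. (f x - g x)\<^sup>2)"
      using L2_diff[OF assms] by (rule L2_integrable_square)
    show "integrable M (\<lambda>x. 2 * (f x)\<^sup>2 + 2 * (g x)\<^sup>2)"
      by (intro Bochner_Integration.integrable_add integrable_mult_right L2_integrable_square assms)
    show "(f x - g x)\<^sup>2 \<le> 2 * (f x)\<^sup>2 + 2 * (g x)\<^sup>2" for x
      by (rule diff_power2_le)
  qed
  then show ?thesis
    using assms by (simp add: L2_norm_power2 L2_integrable_square)
qed

section \<open>Uniqueness of weak derivatives\<close>

text \<open>Open boxes are stable under intersection and generate the Borel sets, and the sets over
  which \<open>f\<close> integrates to 0 form a Dynkin system. Hence all Borel sets have this
  property, and \<open>f\<close> has the same integrals as the zero function.\<close>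

lemma AE_zero_if_box_integrals_zero:
  fixes f :: "'a::euclidean_space \<Rightarrow> real"
  assumes f: "integrable lborel f"
    and box: "\<And>a b. (\<integral>x. indicator (box a b) x * f x \<partial>lborel) = 0"
  shows "AE x in lborel. f x = 0"
proof -
  have si: "set_integrable lborel A f" if "A \<in> sets borel" for A
    unfolding set_integrable_def using integrable_mult_indicator[OF _ f, of A] that by simp
  \<comment> \<open>Closure under complements needs the integral over the whole space, which is not
    a box; growing boxes exhaust it.\<close>
  have UNIV: "(LINT x:UNIV|lborel. f x) = 0"
  proof -
    let ?A = "\<lambda>n::nat. box (- (real n *\<^sub>R One)) (real n *\<^sub>R One) :: 'a set"
    have "(\<lambda>n. LINT x:?A n|lborel. f x) \<longlonglongrightarrow> (LINT x:(\<Union>n. ?A n)|lborel. f x)"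
    proof (rule set_integral_cont_up)
      show "incseq ?A"
        by (intro incseq_SucI) (fastforce simp: mem_box)
    qed (auto intro: si)
    then have "(\<lambda>n. 0::real) \<longlonglongrightarrow> (LINT x:UNIV|lborel. f x)"
      by (simp add: UN_box_eq_UNIV set_lebesgue_integral_def box)
    then show ?thesis using LIMSEQ_unique tendsto_const by blast
  qed
  have "(LINT x:A|lborel. f x) = 0" if A: "A \<in> sets borel" for A
  proof (rule sigma_sets_induct_disjoint[of "range (\<lambda>(a, b). box a b :: 'a set)" UNIV A
        "\<lambda>A. (LINT x:A|lborel. f x) = 0"])
    show "Int_stable (range (\<lambda>(a, b). box a b :: 'a set))"
      by (auto simp: Int_stable_def box_Int_box)
    show sets: "A \<in> sigma_sets UNIV (range (\<lambda>(a, b). box a b :: 'a set))"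
      using A by (simp add: borel_eq_box)
    show "(LINT x:B|lborel. f x) = 0" if "B \<in> range (\<lambda>(a, b). box a b :: 'a set)" for B
      using that box by (auto simp: set_lebesgue_integral_def)
    show "(LINT x:UNIV - B|lborel. f x) = 0"
      if "B \<in> sigma_sets UNIV (range (\<lambda>(a, b). box a b :: 'a set))" "(LINT x:B|lborel. f x) = 0" for B
    proof -
      have B: "B \<in> sets borel" using that(1) by (simp add: borel_eq_box)
      then show ?thesis
        using set_integral_Un[of B "UNIV - B" lborel f] si[of B] si[of "UNIV - B"] UNIV that(2) by simp
    qed
    show "(LINT x:(\<Union>i. B i)|lborel. f x) = 0"
      if "disjoint_family B" "range B \<subseteq> sigma_sets UNIV (range (\<lambda>(a, b). box a b :: 'a set))"
        "\<And>i. (LINT x:B i|lborel. f x) = 0" for B :: "nat \<Rightarrow> 'a set"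
    proof -
      have B: "B i \<in> sets borel" for i using that(2) by (auto simp: borel_eq_box)
      then have "(LINT x:(\<Union>i. B i)|lborel. f x) = (\<Sum>i. LINT x:B i|lborel. f x)"
        using that(1) by (intro lebesgue_integral_countable_add si) (auto simp: disjoint_family_on_def)
      then show ?thesis using that(3) by simp
    qed
  qed (auto simp: set_lebesgue_integral_def)
  then show ?thesis
    by (intro density_unique_real[OF f]) (auto simp: set_lebesgue_integral_def)
qed

text \<open>Boxes generate only the Borel sets, so \<open>f\<close> is replaced by a Borel function
  that agrees with it almost everywhere.\<close>

lemma AE_lebesgue_zero_if_box_integrals_zero:
  fixes f :: "'a::euclidean_space \<Rightarrow> real"
  assumes f: "integrable lebesgue f"
    and box: "\<And>a b. (\<integral>x. indicator (box a b) x * f x \<partial>lebesgue) = 0"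
  shows "AE x in lebesgue. f x = 0"
proof -
  obtain g where g: "g \<in> borel_measurable lborel" "AE x in lborel. f x = g x"
    using completion_ex_borel_measurable_real f by blast
  have fg: "AE x in lebesgue. f x = g x"
    using g(2) by (rule AE_completion)
  have "integrable lebesgue g"
    using f g(1) fg by (subst integrable_cong_AE[symmetric, of f]) (auto simp: measurable_completion)
  then have "integrable lborel g"
    using g(1) by (simp add: integrable_completion)
  moreover have "(\<integral>x. indicator (box a b) x * g x \<partial>lborel) = 0" for a b
  proof -
    have [measurable]: "g \<in> borel_measurable borel" using g(1) by simp
    have [measurable]: "f \<in> borel_measurable lebesgue" using f by auto
    have [measurable]: "g \<in> borel_measurable lebesgue" using g(1) by (rule measurable_completion)
    have "(\<integral>x. indicator (box a b) x * g x \<partial>lborel) = (\<integral>x. indicator (box a b) x * g x \<partial>lebesgue)"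
      by (rule integral_completion[symmetric]) measurable
    also have "\<dots> = (\<integral>x. indicator (box a b) x * f x \<partial>lebesgue)"
      using fg by (intro integral_cong_AE) (auto intro!: borel_measurable_times borel_measurable_indicator)
    finally show ?thesis using box by simp
  qed
  ultimately have "AE x in lborel. g x = 0"
    by (rule AE_zero_if_box_integrals_zero)
  then have "AE x in lebesgue. g x = 0" by (rule AE_completion)
  with fg show ?thesis by eventually_elim simp
qed

text \<open>Test functions reach only boxes whose closure lies in \<open>D\<close>. Cutting
  \<open>w\<close> off to one such box localizes the problem: any other box meets it in a box of the
  same kind, so the cut-off function integrates to 0 over every box. Countably many closed boxes
  then cover \<open>D\<close>.\<close>

lemma fundamental_lemma_calculus_of_variations:
  assumes D: "open D" and w: "w \<in> L2 (lebesgue_on D)"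
    and test: "\<And>\<phi>. test_function D \<phi> \<Longrightarrow> (\<integral>x. w x * \<phi> x \<partial>lebesgue_on D) = 0"
  shows "AE x in lebesgue_on D. w x = 0"
proof -
  have D': "D \<inter> space lebesgue \<in> sets lebesgue" using D by auto
  define W where "W = (\<lambda>x. indicator D x * w x)"
  have W_meas[measurable]: "W \<in> borel_measurable lebesgue"
    using L2_borel_measurable[OF w] borel_measurable_restrict_space_iff[OF D', of w]
    by (simp add: W_def)
  have "(W x)\<^sup>2 = indicator D x *\<^sub>R (w x)\<^sup>2" for x
    by (simp add: W_def indicator_def)
  then have W_sq: "integrable lebesgue (\<lambda>x. (W x)\<^sup>2)"
    using L2_integrable_square[OF w] integrable_restrict_space[OF D', of "\<lambda>x. (w x)\<^sup>2"]
    by simp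
  have W_test: "(\<integral>x. \<phi> x * W x \<partial>lebesgue) = 0" if "test_function D \<phi>" for \<phi>
    using test[OF that] by (simp add: integral_restrict_space[OF D'] W_def ac_simps)
  \<comment> \<open>\<open>W\<close> is only known to be square integrable;
    \<open>\<bar>W x\<bar> \<le> 1 + (W x)\<^sup>2\<close> gives integrability over bounded boxes,
    and with it the dominating function for the limit of the bumps.\<close>
  have cbox_int: "integrable lebesgue (\<lambda>x. indicator (cbox a b) x * W x)" for a b
  proof (rule Bochner_Integration.integrable_bound)
    show "integrable lebesgue (\<lambda>x. indicator (cbox a b) x + (W x)\<^sup>2)"
      using W_sq by (intro Bochner_Integration.integrable_add integrable_real_indicator)
        (use emeasure_bounded_finite[OF bounded_cbox[of a b]] in auto)
    show "AE x in lebesgue. norm (indicator (cbox a b) x * W x) \<le> norm (indicator (cbox a b) x + (W x)\<^sup>2)"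
    proof (rule AE_I2)
      fix x
      have "\<bar>W x\<bar> \<le> 1 + (W x)\<^sup>2"
        using sum_squares_bound[of 1 "\<bar>W x\<bar>"] by simp
      then show "norm (indicator (cbox a b) x * W x) \<le> norm (indicator (cbox a b) x + (W x)\<^sup>2)"
        by (auto simp: indicator_def)
    qed
  qed (auto intro!: borel_measurable_times borel_measurable_indicator)
  have box0: "(\<integral>x. indicator (box a b) x * W x \<partial>lebesgue) = 0" if "cbox a b \<subseteq> D" for a b
  proof -
    have meas: "box_bump n a b \<in> borel_measurable lebesgue" for n
      unfolding box_bump_def
      by (intro measurable_completion)
        (auto intro!: smooth_borel_measurable smooth_tensor smooth1_interval_bump)
    have tf: "test_function D (box_bump (real (Suc n)) a b)" for n
      using that by (intro test_function_box_bump) auto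
    have "(\<lambda>n. \<integral>x. box_bump (real (Suc n)) a b x * W x \<partial>lebesgue)
        \<longlonglongrightarrow> (\<integral>x. indicator (box a b) x * W x \<partial>lebesgue)"
    proof (rule integral_dominated_convergence)
      show "integrable lebesgue (\<lambda>x. \<bar>indicator (cbox a b) x * W x\<bar>)"
        using cbox_int by (rule integrable_abs)
      show "AE x in lebesgue. (\<lambda>n. box_bump (real (Suc n)) a b x * W x)
          \<longlonglongrightarrow> indicator (box a b) x * W x"
        by (intro AE_I2 tendsto_mult box_bump_tendsto tendsto_const)
      show "AE x in lebesgue. norm (box_bump (real (Suc n)) a b x * W x)
          \<le> \<bar>indicator (cbox a b) x * W x\<bar>" for n
      proof (rule AE_I2)
        fix x
        have "\<bar>box_bump (real (Suc n)) a b x\<bar> \<le> indicator (cbox a b) x"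
        proof (cases "x \<in> cbox a b")
          case False
          then have "x \<notin> box a b" using box_subset_cbox by blast
          then have "box_bump (real (Suc n)) a b x = 0"
            using box_bump_nonzero[of "real (Suc n)" a b x] by auto
          then show ?thesis by simp
        qed (use box_bump_bounds[of "real (Suc n)" a b x] in simp)
        then show "norm (box_bump (real (Suc n)) a b x * W x) \<le> \<bar>indicator (cbox a b) x * W x\<bar>"
          by (auto simp: abs_mult intro!: mult_right_mono)
      qed
    qed (auto intro!: borel_measurable_times borel_measurable_indicator meas)
    moreover have "(\<integral>x. box_bump (real (Suc n)) a b x * W x \<partial>lebesgue) = 0" for n
      by (rule W_test[OF tf])
    ultimately show ?thesis
      using LIMSEQ_unique tendsto_const by (simp del: of_nat_Suc) blast
  qed
  have cbox_AE: "AE x in lebesgue. x \<in> cbox a b \<longrightarrow> W x = 0" if sub: "cbox a b \<subseteq> D" for a b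
  proof -
    have "AE x in lebesgue. indicator (box a b) x * W x = 0"
    proof (rule AE_lebesgue_zero_if_box_integrals_zero)
      show "integrable lebesgue (\<lambda>x. indicator (box a b) x * W x)"
      proof (rule Bochner_Integration.integrable_bound[OF cbox_int[of a b]])
        show "AE x in lebesgue. norm (indicator (box a b) x * W x) \<le> norm (indicator (cbox a b) x * W x)"
          using box_subset_cbox[of a b] by (auto simp: indicator_def intro!: AE_I2)
      qed (auto intro!: borel_measurable_times borel_measurable_indicator)
      show "(\<integral>x. indicator (box a' b') x * (indicator (box a b) x * W x) \<partial>lebesgue) = 0" for a' b'
      proof -
        obtain a'' b'' where box'': "box a' b' \<inter> box a b = box a'' b''"
          by (simp add: box_Int_box)
        have "(\<integral>x. indicator (box a' b') x * (indicator (box a b) x * W x) \<partial>lebesgue)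
            = (\<integral>x. indicator (box a'' b'') x * W x \<partial>lebesgue)"
          unfolding box''[symmetric] by (simp add: indicator_inter_arith mult.assoc)
        also have "\<dots> = 0"
        \<comment> \<open>A degenerate open box is empty although its closed box may not be; only
          for a nonempty one is \<open>cbox a'' b''\<close> the closure and thus contained in
          \<open>cbox a b\<close>.\<close>
        proof (cases "box a'' b'' = {}")
          case False
          have "box a'' b'' \<subseteq> cbox a b" using box'' box_subset_cbox by blast
          then have "cbox a'' b'' \<subseteq> cbox a b"
            using closure_minimal[OF _ closed_cbox, of "box a'' b''"] closure_box[OF False] by simp
          then show ?thesis using sub by (intro box0) auto
        qed simp
        finally show ?thesis .
      qed
    qed
    \<comment> \<open>The cover of \<open>D\<close> consists of closed boxes, so the boundary of the
      box is added as a null set.\<close>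
    moreover have "AE x in lebesgue. x \<notin> cbox a b - box a b"
      using negligible_frontier_interval[of a b] unfolding negligible_iff_null_sets by (rule AE_not_in)
    ultimately show ?thesis
      by eventually_elim (auto simp: indicator_def split: if_splits)
  qed
  obtain \<D> where \<D>: "countable \<D>" "\<D> \<subseteq> Pow D" "\<And>X. X \<in> \<D> \<Longrightarrow> \<exists>a b. X = cbox a b" "\<Union>\<D> = D"
    using open_countable_Union_open_cbox[OF D] by metis
  have "AE x in lebesgue. \<forall>X\<in>\<D>. x \<in> X \<longrightarrow> W x = 0"
  proof (subst AE_ball_countable[OF \<D>(1)], rule ballI)
    fix X assume X: "X \<in> \<D>"
    then obtain a b where "X = cbox a b" using \<D>(3) by blast
    then show "AE x in lebesgue. x \<in> X \<longrightarrow> W x = 0" using cbox_AE X \<D>(2) by blast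
  qed
  then have "AE x in lebesgue. x \<in> D \<longrightarrow> W x = 0"
    by eventually_elim (metis UnionE \<D>(4))
  then have "AE x in lebesgue. x \<in> D \<longrightarrow> w x = 0"
    by eventually_elim (simp add: W_def)
  then show ?thesis
    by (simp add: AE_restrict_space_iff[OF D'])
qed

lemma continuous_compact_support_L2:
  fixes \<phi> :: "pt \<Rightarrow> real"
  assumes D: "D \<in> sets lebesgue" and "continuous_on UNIV \<phi>" "compact (closure {x. \<phi> x \<noteq> 0})"
  shows "\<phi> \<in> L2 (lebesgue_on D)"
proof -
  have D': "D \<inter> space lebesgue \<in> sets lebesgue" using D by auto
  let ?C = "closure {x. \<phi> x \<noteq> 0}"
  have "(\<lambda>x. indicator ?C x *\<^sub>R (\<phi> x)\<^sup>2) = (\<lambda>x. (\<phi> x)\<^sup>2)"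
    using closure_subset[of "{x. \<phi> x \<noteq> 0}"] by (auto simp: indicator_def fun_eq_iff)
  moreover have "continuous_on ?C (\<lambda>x. (\<phi> x)\<^sup>2)"
    using assms(2) by (intro continuous_on_power) (rule continuous_on_subset, auto)
  ultimately have "integrable lborel (\<lambda>x. (\<phi> x)\<^sup>2)"
    using borel_integrable_compact[OF assms(3), of "\<lambda>x. (\<phi> x)\<^sup>2"] by simp
  moreover have meas: "\<phi> \<in> borel_measurable borel"
    using assms(2) by (rule borel_measurable_continuous_onI)
  ultimately have "integrable lebesgue (\<lambda>x. (\<phi> x)\<^sup>2)"
    by (subst integrable_completion) auto
  then have "integrable (lebesgue_on D) (\<lambda>x. (\<phi> x)\<^sup>2)"
    using integrable_mult_indicator[of D lebesgue "\<lambda>x. (\<phi> x)\<^sup>2"] D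
    by (simp add: integrable_restrict_space[OF D'])
  moreover have "\<phi> \<in> borel_measurable (lebesgue_on D)"
    using meas by (intro measurable_restrict_space1 measurable_completion) auto
  ultimately show ?thesis by (simp add: L2_def)
qed

lemma test_function_L2: "D \<in> sets lebesgue \<Longrightarrow> test_function D \<phi> \<Longrightarrow> \<phi> \<in> L2 (lebesgue_on D)"
  unfolding test_function_def by (intro continuous_compact_support_L2 smooth_continuous_on) auto

lemma is_weak_D_unique:
  assumes D: "open D" and "is_weak_D D a0 a1 a2 u w" "is_weak_D D a0 a1 a2 u w'"
  shows "AE x in lebesgue_on D. w x = w' x"
proof -
  have w: "w \<in> L2 (lebesgue_on D)" "w' \<in> L2 (lebesgue_on D)"
    using assms by (auto simp: is_weak_D_def)
  have "AE x in lebesgue_on D. w x - w' x = 0"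
  proof (rule fundamental_lemma_calculus_of_variations[OF D L2_diff[OF w]])
    fix \<phi> assume \<phi>: "test_function D \<phi>"
    have "\<phi> \<in> L2 (lebesgue_on D)"
      using D \<phi> by (intro test_function_L2) auto
    then have "(\<integral>x. (w x - w' x) * \<phi> x \<partial>lebesgue_on D)
        = (\<integral>x. w x * \<phi> x \<partial>lebesgue_on D) - (\<integral>x. w' x * \<phi> x \<partial>lebesgue_on D)"
      using w by (simp add: left_diff_distrib L2_integrable_mult)
    moreover have "(-1) ^ (a0 + a1 + a2) * (\<integral>x. w x * \<phi> x \<partial>lebesgue_on D)
       = (-1) ^ (a0 + a1 + a2) * (\<integral>x. w' x * \<phi> x \<partial>lebesgue_on D)"
      using assms \<phi> by (auto simp: is_weak_D_def)
    ultimately show "(\<integral>x. (w x - w' x) * \<phi> x \<partial>lebesgue_on D) = 0"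
      by simp
  qed
  then show ?thesis by eventually_elim simp
qed

section \<open>Change of variables\<close>

text \<open>The common form of all changes of variables below: \<open>N\<close> is \<open>k\<close>
  times the push-forward of \<open>M\<close>. Lebesgue measure has \<open>k = c\<close>, surface
  measures have \<open>k = c\<close> or \<open>k = 1\<close>.\<close>

lemma integral_scaled_distr:
  fixes f :: "'b \<Rightarrow> real"
  assumes T: "T \<in> measurable M N" and N: "N = density (distr M N T) (\<lambda>_. ennreal k)" and k: "k > 0"
    and f: "f \<in> borel_measurable N"
  shows "(\<integral>x. f x \<partial>N) = k * (\<integral>x. f (T x) \<partial>M)"
    and "integrable N f \<longleftrightarrow> integrable M (\<lambda>x. f (T x))"
proof -
  \<comment> \<open>\<open>N\<close> occurs on both sides of its own equation, so the computation
    runs on the right-hand side, which is folded back to \<open>N\<close> at the end.\<close>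
  let ?N = "density (distr M N T) (\<lambda>_. ennreal k)"
  have "(\<integral>x. f x \<partial>?N) = k * (\<integral>x. f (T x) \<partial>M)"
    using T f k by (subst integral_density) (auto simp: integral_distr)
  then show "(\<integral>x. f x \<partial>N) = k * (\<integral>x. f (T x) \<partial>M)"
    by (simp only: N[symmetric])
  have "integrable ?N f \<longleftrightarrow> integrable M (\<lambda>x. f (T x))"
    using T f k by (subst integrable_density) (auto simp: integrable_distr_eq)
  then show "integrable N f \<longleftrightarrow> integrable M (\<lambda>x. f (T x))"
    by (simp only: N[symmetric])
qed

lemma L2_scaled_distr:
  assumes T: "T \<in> measurable M N" and N: "N = density (distr M N T) (\<lambda>_. ennreal k)" and k: "k > 0"
  shows L2_compose: "f \<in> L2 N \<Longrightarrow> (\<lambda>x. f (T x)) \<in> L2 M"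
    and L2_norm_compose: "f \<in> borel_measurable N \<Longrightarrow> L2_norm N f = sqrt k * L2_norm M (\<lambda>x. f (T x))"
proof -
  show "(\<lambda>x. f (T x)) \<in> L2 M" if "f \<in> L2 N"
    using that integral_scaled_distr(2)[OF T N k, of "\<lambda>x. (f x)\<^sup>2"] measurable_compose[OF T]
    by (auto simp: L2_def)
  show "L2_norm N f = sqrt k * L2_norm M (\<lambda>x. f (T x))" if "f \<in> borel_measurable N"
    using that integral_scaled_distr(1)[OF T N k, of "\<lambda>x. (f x)\<^sup>2"]
    by (simp add: L2_norm_def real_sqrt_mult)
qed

text \<open>By injectivity the preimage of a subset of the image of \<open>A\<close> already lies in
  \<open>A\<close>, so restricting both spaces leaves the measures of these two sets
  unchanged.\<close>

lemma restrict_space_scaled_distr: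
  assumes T: "T \<in> measurable M N" and N: "N = density (distr M N T) (\<lambda>_. ennreal k)"
    and inj: "inj T" and sp: "space M = UNIV" and A: "A \<in> sets M" "T ` A \<in> sets N"
  shows "T \<in> measurable (restrict_space M A) (restrict_space N (T ` A))"
    and "restrict_space N (T ` A)
       = density (distr (restrict_space M A) (restrict_space N (T ` A)) T) (\<lambda>_. ennreal k)"
proof -
  let ?M = "restrict_space M A" and ?N = "restrict_space N (T ` A)"
  show T': "T \<in> measurable ?M ?N"
    using T by (intro measurable_restrict_space3) auto
  show "?N = density (distr ?M ?N T) (\<lambda>_. ennreal k)"
  proof (rule measure_eqI)
    fix B assume "B \<in> sets ?N"
    then have B: "B \<in> sets N" "B \<subseteq> T ` A"
      using A by (auto simp: sets_restrict_space_iff)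
    have vA: "T -` B \<subseteq> A" using B(2) inj by (auto dest: injD)
    have vM: "T -` B \<in> sets M" using measurable_sets[OF T B(1)] sp by simp
    have "emeasure N B = emeasure (density (distr M N T) (\<lambda>_. ennreal k)) B"
      by (simp only: N[symmetric])
    also have "\<dots> = ennreal k * emeasure M (T -` B)"
      using T B(1) sp by (subst emeasure_density) (auto simp: nn_integral_cmult emeasure_distr)
    also have "emeasure M (T -` B) = emeasure ?M (T -` B)"
      using vA A by (simp add: emeasure_restrict_space)
    also have "T -` B = T -` B \<inter> space ?M"
      using vA sp by (auto simp: space_restrict_space)
    also have "ennreal k * emeasure ?M (T -` B \<inter> space ?M) = emeasure (density (distr ?M ?N T) (\<lambda>_. ennreal k)) B"
      using T' \<open>B \<in> sets ?N\<close> by (subst emeasure_density) (auto simp: nn_integral_cmult emeasure_distr)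
    finally show "emeasure ?N B = emeasure (density (distr ?M ?N T) (\<lambda>_. ennreal k)) B"
      using A B by (simp add: emeasure_restrict_space)
  qed simp
qed

lemma scaled_distrI:
  assumes T: "T \<in> measurable M N"
    and nn: "\<And>f. f \<in> borel_measurable N \<Longrightarrow> (\<integral>\<^sup>+x. f x \<partial>N) = ennreal k * (\<integral>\<^sup>+x. f (T x) \<partial>M)"
  shows "N = density (distr M N T) (\<lambda>_. ennreal k)"
proof (rule measure_eqI)
  fix B assume B: "B \<in> sets N"
  have "emeasure N B = ennreal k * (\<integral>\<^sup>+x. indicator B (T x) \<partial>M)"
    using nn[of "indicator B"] B by simp
  also have "\<dots> = ennreal k * emeasure (distr M N T) B"
    using T B by (simp add: nn_integral_distr[symmetric])
  finally show "emeasure N B = emeasure (density (distr M N T) (\<lambda>_. ennreal k)) B"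
    using B by (simp add: emeasure_density nn_integral_cmult)
qed simp

lemma lebesgue_stretch:
  assumes c: "c > 0"
  shows "stretch c b \<in> measurable lebesgue lebesgue"
    and "lebesgue = density (distr lebesgue lebesgue (stretch c b)) (\<lambda>_. ennreal c)"
proof -
  let ?k = "\<lambda>j::pt. if j = (1, 0, 0) then c else 1"
  have *: "(\<lambda>x. (b, 0, 0) + (\<Sum>j\<in>Basis. (?k j * (x \<bullet> j)) *\<^sub>R j)) = stretch c b"
    by (auto simp: Basis_pt zero_prod_def)
  have **: "(\<Prod>j\<in>Basis. \<bar>?k j\<bar>) = c"
    using c by (simp add: Basis_pt)
  show "stretch c b \<in> measurable lebesgue lebesgue"
    using lebesgue_affine_measurable[of ?k "(b, 0, 0)"] c unfolding * by simp
  show "lebesgue = density (distr lebesgue lebesgue (stretch c b)) (\<lambda>_. ennreal c)"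
    using lebesgue_affine_euclidean[of ?k "(b, 0, 0)"] c unfolding * ** by simp
qed

text \<open>Measurability passes to preimages, not to images in general; this form makes images
  under the stretch measurable through its inverse.\<close>

lemma stretch_image_eq_vimage:
  assumes "c \<noteq> 0" shows "stretch c b ` A = stretch (1 / c) (- b / c) -` A"
proof (rule set_eqI)
  fix x
  show "x \<in> stretch c b ` A \<longleftrightarrow> x \<in> stretch (1 / c) (- b / c) -` A"
    using stretch_inverse[OF assms, of b] by (metis image_iff vimage_eq)
qed

lemma stretch_image_lebesgue:
  assumes "c > 0" "D \<in> sets lebesgue" shows "stretch c b ` D \<in> sets lebesgue"
proof -
  have "stretch (1 / c) (- b / c) -` D \<inter> space lebesgue \<in> sets lebesgue"
    using assms by (intro measurable_sets[OF lebesgue_stretch(1)]) auto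
  then show ?thesis using assms(1) by (simp add: stretch_image_eq_vimage)
qed

lemma stretch_image_borel:
  assumes "c > 0" "D \<in> sets borel" shows "stretch c b ` D \<in> sets borel"
proof -
  have "stretch (1 / c) (- b / c) -` D \<inter> space borel \<in> sets borel"
    using assms(2)
    by (intro measurable_sets[OF borel_measurable_continuous_onI[OF continuous_on_stretch]]) auto
  then show ?thesis using assms(1) by (simp add: stretch_image_eq_vimage)
qed

lemma lebesgue_on_stretch:
  assumes "c > 0" "D \<in> sets lebesgue"
  shows "stretch c b \<in> measurable (lebesgue_on D) (lebesgue_on (stretch c b ` D))"
    and "lebesgue_on (stretch c b ` D)
      = density (distr (lebesgue_on D) (lebesgue_on (stretch c b ` D)) (stretch c b)) (\<lambda>_. ennreal c)"
proof -
  have inj: "inj (stretch c b)"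
    using assms(1) bij_stretch[of c b] by (simp add: bij_is_inj)
  note * = restrict_space_scaled_distr[OF lebesgue_stretch[OF assms(1), of b] inj _ assms(2)
      stretch_image_lebesgue[OF assms]]
  show "stretch c b \<in> measurable (lebesgue_on D) (lebesgue_on (stretch c b ` D))"
    by (rule *(1)) simp
  show "lebesgue_on (stretch c b ` D)
      = density (distr (lebesgue_on D) (lebesgue_on (stretch c b ` D)) (stretch c b)) (\<lambda>_. ennreal c)"
    by (rule *(2)) simp
qed

lemma smooth_measurable_lebesgue_on: "smooth f \<Longrightarrow> f \<in> borel_measurable (lebesgue_on D)"
  by (intro measurable_restrict_space1 measurable_completion) (simp add: smooth_borel_measurable)

section \<open>Weak derivatives and traces on a stretched domain\<close>

lemma test_function_stretch:
  assumes c: "c > 0" and \<phi>: "test_function D \<phi>"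
  obtains \<psi> where "test_function (stretch c b ` D) \<psi>"
    \<comment> \<open>the factor \<open>1\<close> is the \<open>m\<close> of \<open>partial_D_stretch\<close>\<close>
    "\<phi> = (\<lambda>x. 1 * \<psi> (stretch c b x))"
proof
  let ?S = "stretch (1 / c) (- b / c)"
  let ?\<psi> = "\<lambda>x. 1 * \<phi> (?S x)"
  have c0: "c \<noteq> 0" using c by simp
  show "\<phi> = (\<lambda>x. 1 * ?\<psi> (stretch c b x))"
    by (simp only: stretch_inverse[OF c0] mult_1_left)
  have "{x. ?\<psi> x \<noteq> 0} = stretch c b ` {x. \<phi> x \<noteq> 0}"
    unfolding stretch_image_eq_vimage[OF c0] by auto
  also have "\<dots> \<subseteq> stretch c b ` closure {x. \<phi> x \<noteq> 0}"
    by (intro image_mono closure_subset)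
  finally have sub: "{x. ?\<psi> x \<noteq> 0} \<subseteq> stretch c b ` closure {x. \<phi> x \<noteq> 0}" .
  have comp: "compact (stretch c b ` closure {x. \<phi> x \<noteq> 0})"
    using \<phi> by (intro compact_continuous_image continuous_on_stretch) (simp add: test_function_def)
  have cl: "closure {x. ?\<psi> x \<noteq> 0} \<subseteq> stretch c b ` closure {x. \<phi> x \<noteq> 0}"
    using sub comp by (intro closure_minimal compact_imp_closed)
  show "test_function (stretch c b ` D) ?\<psi>"
    unfolding test_function_def
  proof (intro conjI)
    show "smooth ?\<psi>" using \<phi> by (intro smooth_stretch) (simp add: test_function_def)
    show "compact (closure {x. ?\<psi> x \<noteq> 0})"
      using cl comp by (meson bounded_subset closed_closure compact_eq_bounded_closed)
    show "closure {x. ?\<psi> x \<noteq> 0} \<subseteq> stretch c b ` D"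
      using cl \<phi> unfolding test_function_def by (meson image_mono order_trans)
  qed
qed

text \<open>Every test function on \<open>D\<close> is a test function on the image composed with
  the stretch. Its derivative yields the factor \<open>c ^ a0\<close>, which moves over to
  \<open>w\<close>; the Jacobian \<open>c\<close> appears on both sides and cancels.\<close>

lemma is_weak_D_stretch:
  assumes c: "c > 0" and D: "D \<in> sets lebesgue"
    and w: "is_weak_D (stretch c b ` D) a0 a1 a2 u w"
  shows "is_weak_D D a0 a1 a2 (\<lambda>x. m * u (stretch c b x)) (\<lambda>x. m * c ^ a0 * w (stretch c b x))"
proof -
  let ?T = "stretch c b" and ?D = "stretch c b ` D"
  note T = lebesgue_on_stretch[OF c D, of b]
  have L2: "u \<in> L2 (lebesgue_on ?D)" "w \<in> L2 (lebesgue_on ?D)"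
    using w by (auto simp: is_weak_D_def)
  have "(\<integral>x. m * u (?T x) * partial_D a0 a1 a2 \<phi> x \<partial>lebesgue_on D)
      = (- 1) ^ (a0 + a1 + a2) * (\<integral>x. m * c ^ a0 * w (?T x) * \<phi> x \<partial>lebesgue_on D)"
    if \<phi>: "test_function D \<phi>" for \<phi>
  proof -
    obtain \<psi> where \<psi>: "test_function ?D \<psi>" "\<phi> = (\<lambda>x. 1 * \<psi> (?T x))"
      using test_function_stretch[OF c \<phi>] .
    have sm: "smooth \<psi>" using \<psi>(1) by (simp add: test_function_def)
    have meas: "(\<lambda>y. u y * partial_D a0 a1 a2 \<psi> y) \<in> borel_measurable (lebesgue_on ?D)"
      "(\<lambda>y. w y * \<psi> y) \<in> borel_measurable (lebesgue_on ?D)"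
      by (intro borel_measurable_times L2_borel_measurable L2 smooth_measurable_lebesgue_on
          smooth_partial_D sm)+
    \<comment> \<open>The additional factor \<open>c\<close> produces the exact pattern of the
      change of variables and is cancelled at the end.\<close>
    have "c * (\<integral>x. m * u (?T x) * partial_D a0 a1 a2 \<phi> x \<partial>lebesgue_on D)
        = m * c ^ a0 * (c * (\<integral>x. u (?T x) * partial_D a0 a1 a2 \<psi> (?T x) \<partial>lebesgue_on D))"
      unfolding \<psi>(2) partial_D_stretch[OF sm] integral_mult_right_zero[symmetric]
      by (intro Bochner_Integration.integral_cong) (auto simp: ac_simps)
    also have "\<dots> = m * c ^ a0 * (\<integral>y. u y * partial_D a0 a1 a2 \<psi> y \<partial>lebesgue_on ?D)"
      by (subst integral_scaled_distr(1)[OF T c meas(1)]) simp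
    also have "\<dots> = m * c ^ a0 * ((- 1) ^ (a0 + a1 + a2) * (\<integral>y. w y * \<psi> y \<partial>lebesgue_on ?D))"
      using w \<psi>(1) by (simp add: is_weak_D_def)
    also have "\<dots> = m * c ^ a0 * ((- 1) ^ (a0 + a1 + a2) * (c * (\<integral>x. w (?T x) * \<psi> (?T x) \<partial>lebesgue_on D)))"
      by (subst integral_scaled_distr(1)[OF T c meas(2)]) simp
    also have "\<dots> = c * ((- 1) ^ (a0 + a1 + a2) * (\<integral>x. m * c ^ a0 * w (?T x) * \<phi> x \<partial>lebesgue_on D))"
      unfolding \<psi>(2) integral_mult_right_zero[symmetric]
      by (intro Bochner_Integration.integral_cong) (auto simp: ac_simps)
    finally show ?thesis using c by simp
  qed
  then show ?thesis
    using L2_cmult[OF L2_compose[OF T c L2(1)], of m] L2_cmult[OF L2_compose[OF T c L2(2)], of "m * c ^ a0"]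
    unfolding is_weak_D_def by blast
qed

lemma is_weak_D_cong_AE:
  assumes w: "is_weak_D D a0 a1 a2 u w" and u': "u' \<in> L2 (lebesgue_on D)"
    and AE: "AE x in lebesgue_on D. u' x = u x"
  shows "is_weak_D D a0 a1 a2 u' w"
proof -
  have "(\<integral>x. u' x * partial_D a0 a1 a2 \<phi> x \<partial>lebesgue_on D)
      = (\<integral>x. u x * partial_D a0 a1 a2 \<phi> x \<partial>lebesgue_on D)" if "test_function D \<phi>" for \<phi>
  proof (rule integral_cong_AE)
    show "AE x in lebesgue_on D. u' x * partial_D a0 a1 a2 \<phi> x = u x * partial_D a0 a1 a2 \<phi> x"
      using AE by eventually_elim simp
    have \<phi>: "smooth \<phi>" using that by (simp add: test_function_def)
    have u: "u \<in> L2 (lebesgue_on D)" using w by (simp add: is_weak_D_def)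
    show "(\<lambda>x. u' x * partial_D a0 a1 a2 \<phi> x) \<in> borel_measurable (lebesgue_on D)"
      "(\<lambda>x. u x * partial_D a0 a1 a2 \<phi> x) \<in> borel_measurable (lebesgue_on D)"
      by (intro borel_measurable_times L2_borel_measurable[OF u'] L2_borel_measurable[OF u]
          smooth_measurable_lebesgue_on smooth_partial_D \<phi>)+
  qed
  then show ?thesis using w u' unfolding is_weak_D_def by simp
qed

lemma is_weak_D_weak_D: "weak_D_exists D a0 a1 a2 u \<Longrightarrow> is_weak_D D a0 a1 a2 u (weak_D D a0 a1 a2 u)"
  unfolding weak_D_exists_def weak_D_def by (rule someI_ex[of "is_weak_D D a0 a1 a2 u"])

text \<open>Agreement of \<open>v'\<close> with the transported function is required only almost
  everywhere, because \<open>v'\<close> may itself be a chosen weak derivative, known only up to a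
  null set. Uniqueness on \<open>D\<close> identifies the choice made by
  \<open>weak_D\<close>.\<close>

lemma weak_D_stretch:
  assumes c: "c > 0" and D: "open D"
    and ex: "weak_D_exists (stretch c b ` D) a0 a1 a2 v"
    and v': "v' \<in> L2 (lebesgue_on D)" "AE x in lebesgue_on D. v' x = m * v (stretch c b x)"
  shows "weak_D_exists D a0 a1 a2 v'"
    and "AE x in lebesgue_on D. weak_D D a0 a1 a2 v' x
       = m * c ^ a0 * weak_D (stretch c b ` D) a0 a1 a2 v (stretch c b x)"
proof -
  have D': "D \<in> sets lebesgue" using D by auto
  have *: "is_weak_D D a0 a1 a2 v' (\<lambda>x. m * c ^ a0 * weak_D (stretch c b ` D) a0 a1 a2 v (stretch c b x))"
    using is_weak_D_weak_D[OF ex] by (intro is_weak_D_cong_AE[OF is_weak_D_stretch[OF c D'] v'])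
  then show ex': "weak_D_exists D a0 a1 a2 v'" unfolding weak_D_exists_def by blast
  show "AE x in lebesgue_on D. weak_D D a0 a1 a2 v' x
       = m * c ^ a0 * weak_D (stretch c b ` D) a0 a1 a2 v (stretch c b x)"
    by (rule is_weak_D_unique[OF D is_weak_D_weak_D[OF ex'] *])
qed

lemma weak_D_L2: "weak_D_exists D a0 a1 a2 u \<Longrightarrow> weak_D D a0 a1 a2 u \<in> L2 (lebesgue_on D)"
  using is_weak_D_weak_D by (auto simp: is_weak_D_def)

text \<open>The approximating sequence is transported together with \<open>v\<close> and
  \<open>g\<close>. Each error norm is multiplied by a factor that does not depend on
  \<open>n\<close>, namely \<open>\<bar>m * c ^ a0\<bar> / sqrt c\<close> in the volume and
  \<open>\<bar>m\<bar> / sqrt k\<close> on the face, so convergence to 0 is kept.\<close>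

lemma is_trace_stretch:
  assumes c: "c > 0" and D: "open D" and k: "k > 0"
    and T: "stretch c b \<in> measurable \<sigma> \<sigma>'"
    and \<sigma>': "\<sigma>' = density (distr \<sigma> \<sigma>' (stretch c b)) (\<lambda>_. ennreal k)"
    and borel: "(\<lambda>x. x) \<in> measurable \<sigma>' borel"
    and tr: "is_trace rt rs (stretch c b ` D) \<sigma>' v g"
    and v': "v' \<in> L2 (lebesgue_on D)" "AE x in lebesgue_on D. v' x = m * v (stretch c b x)"
  shows "is_trace rt rs D \<sigma> v' (\<lambda>x. m * g (stretch c b x))"
proof -
  let ?T = "stretch c b" and ?D = "stretch c b ` D"
  have D': "D \<in> sets lebesgue" using D by auto
  note TD = lebesgue_on_stretch[OF c D', of b]
  obtain \<phi> where v: "v \<in> sobolev rt rs ?D" and g: "g \<in> L2 \<sigma>'" and sm: "\<And>n. smooth (\<phi> n)"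
    and lim: "\<And>a0 a1 a2. a0 \<le> rt \<Longrightarrow> a1 + a2 \<le> rs \<Longrightarrow>
      (\<lambda>n. L2_norm (lebesgue_on ?D) (\<lambda>x. partial_D a0 a1 a2 (\<phi> n) x - weak_D ?D a0 a1 a2 v x)) \<longlonglongrightarrow> 0"
    and limg: "(\<lambda>n. L2_norm \<sigma>' (\<lambda>x. \<phi> n x - g x)) \<longlonglongrightarrow> 0"
    using tr unfolding is_trace_def by blast
  have "v' \<in> sobolev rt rs D"
    using v v'(1) weak_D_stretch(1)[OF c D _ v'] by (auto simp: sobolev_def)
  moreover have "(\<lambda>x. m * g (?T x)) \<in> L2 \<sigma>"
    by (rule L2_cmult[OF L2_compose[OF T \<sigma>' k g]])
  moreover have "smooth (\<lambda>x. m * \<phi> n (?T x))" for n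
    by (rule smooth_stretch[OF sm])
  moreover have "(\<lambda>n. L2_norm (lebesgue_on D)
      (\<lambda>x. partial_D a0 a1 a2 (\<lambda>x. m * \<phi> n (?T x)) x - weak_D D a0 a1 a2 v' x)) \<longlonglongrightarrow> 0"
    if a: "a0 \<le> rt" "a1 + a2 \<le> rs" for a0 a1 a2
  proof -
    let ?d = "\<lambda>n x. partial_D a0 a1 a2 (\<phi> n) x - weak_D ?D a0 a1 a2 v x"
    have ex: "weak_D_exists ?D a0 a1 a2 v" using v a by (simp add: sobolev_def)
    have d: "?d n \<in> borel_measurable (lebesgue_on ?D)" for n
      by (intro borel_measurable_diff smooth_measurable_lebesgue_on smooth_partial_D sm
          L2_borel_measurable weak_D_L2 ex)
    have "L2_norm (lebesgue_on D) (\<lambda>x. partial_D a0 a1 a2 (\<lambda>x. m * \<phi> n (?T x)) x - weak_D D a0 a1 a2 v' x)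
        = L2_norm (lebesgue_on D) (\<lambda>x. m * c ^ a0 * ?d n (?T x))" for n
    proof (rule L2_norm_cong_AE)
      show "(\<lambda>x. partial_D a0 a1 a2 (\<lambda>x. m * \<phi> n (?T x)) x - weak_D D a0 a1 a2 v' x)
          \<in> borel_measurable (lebesgue_on D)"
        by (intro borel_measurable_diff smooth_measurable_lebesgue_on smooth_partial_D smooth_stretch sm
            L2_borel_measurable weak_D_L2 weak_D_stretch(1)[OF c D ex v'])
      show "(\<lambda>x. m * c ^ a0 * ?d n (?T x)) \<in> borel_measurable (lebesgue_on D)"
        by (intro borel_measurable_times borel_measurable_const measurable_compose[OF TD(1) d])
      show "AE x in lebesgue_on D. partial_D a0 a1 a2 (\<lambda>x. m * \<phi> n (?T x)) x - weak_D D a0 a1 a2 v' x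
          = m * c ^ a0 * ?d n (?T x)"
        using weak_D_stretch(2)[OF c D ex v']
        by eventually_elim (simp add: partial_D_stretch[OF sm] algebra_simps)
    qed
    also have "\<dots> n = \<bar>m * c ^ a0\<bar> / sqrt c * L2_norm (lebesgue_on ?D) (?d n)" for n
      using c by (simp only: L2_norm_cmult L2_norm_compose[OF TD c d]) simp
    finally have "(\<lambda>n. L2_norm (lebesgue_on D)
        (\<lambda>x. partial_D a0 a1 a2 (\<lambda>x. m * \<phi> n (?T x)) x - weak_D D a0 a1 a2 v' x))
      = (\<lambda>n. \<bar>m * c ^ a0\<bar> / sqrt c * L2_norm (lebesgue_on ?D) (?d n))" by blast
    then show ?thesis
      using tendsto_mult_left[OF lim[OF a], of "\<bar>m * c ^ a0\<bar> / sqrt c"] by simp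
  qed
  moreover have "(\<lambda>n. L2_norm \<sigma> (\<lambda>x. m * \<phi> n (?T x) - m * g (?T x))) \<longlonglongrightarrow> 0"
  proof -
    have d: "(\<lambda>x. \<phi> n x - g x) \<in> borel_measurable \<sigma>'" for n
      using measurable_compose[OF borel smooth_borel_measurable[OF sm]]
      by (intro borel_measurable_diff L2_borel_measurable[OF g]) auto
    have "L2_norm \<sigma> (\<lambda>x. m * \<phi> n (?T x) - m * g (?T x))
        = \<bar>m\<bar> / sqrt k * L2_norm \<sigma>' (\<lambda>x. \<phi> n x - g x)" for n
      using k L2_norm_cmult[of \<sigma> m "\<lambda>x. \<phi> n (?T x) - g (?T x)"]
      by (simp add: L2_norm_compose[OF T \<sigma>' k d] right_diff_distrib)
    then show ?thesis
      using tendsto_mult_left[OF limg, of "\<bar>m\<bar> / sqrt k"] by simp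
  qed
  ultimately show ?thesis
    unfolding is_trace_def
    by (intro conjI exI[of _ "\<lambda>n x. m * \<phi> n (?T x)"] allI impI; blast)
qed

section \<open>Surface measure\<close>

definition gram :: "pt \<Rightarrow> pt \<Rightarrow> ennreal" where
  "gram v w = ennreal (sqrt ((v \<bullet> v) * (w \<bullet> w) - (v \<bullet> w)\<^sup>2))"

lemma sets_planes_measure [simp]: "sets (planes_measure P v w) = sets borel"
  by (simp add: planes_measure_def)

lemma space_planes_measure [simp]: "space (planes_measure P v w) = UNIV"
  by (simp add: planes_measure_def)

lemma measurable_planes_measure [simp]:
  "measurable (planes_measure P v w) N = measurable borel N"
  "measurable N (planes_measure P v w) = measurable N borel"
  by (rule measurable_cong_sets; simp)+

lemma borel_measurable_plane: "(\<lambda>z::real \<times> real. p + fst z *\<^sub>R v + snd z *\<^sub>R w) \<in> borel_measurable borel"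
  for p v w :: pt
  by (intro borel_measurable_continuous_onI continuous_intros)

lemma nn_integral_planes_measure:
  assumes P: "finite P" and f[measurable]: "f \<in> borel_measurable borel"
  shows "(\<integral>\<^sup>+x. f x \<partial>planes_measure P v w)
    = gram v w * (\<Sum>p\<in>P. \<integral>\<^sup>+z. f (p + fst z *\<^sub>R v + snd z *\<^sub>R w) \<partial>lborel)"
proof -
  let ?F = "\<lambda>(p, s, r). p + s *\<^sub>R v + r *\<^sub>R w"
  have F: "?F \<in> measurable (count_space P \<Otimes>\<^sub>M lborel) borel"
    using borel_measurable_plane[of _ v w] P
    by (intro measurable_pair_measure_countable1) (auto simp: case_prod_beta intro: countable_finite)
  have "(\<integral>\<^sup>+x. f x \<partial>planes_measure P v w)
      = gram v w * (\<integral>\<^sup>+x. f (?F x) \<partial>(count_space P \<Otimes>\<^sub>M lborel))"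
    unfolding planes_measure_def gram_def
    by (subst nn_integral_density) (auto simp: nn_integral_cmult nn_integral_distr[OF F])
  also have "(\<integral>\<^sup>+x. f (?F x) \<partial>(count_space P \<Otimes>\<^sub>M lborel))
      = (\<integral>\<^sup>+p. \<integral>\<^sup>+z. f (?F (p, z)) \<partial>lborel \<partial>count_space P)"
    by (rule lborel.nn_integral_fst[symmetric]) (rule measurable_compose[OF F f])
  also have "\<dots> = (\<Sum>p\<in>P. \<integral>\<^sup>+z. f (p + fst z *\<^sub>R v + snd z *\<^sub>R w) \<partial>lborel)"
    using P by (simp add: nn_integral_count_space_finite case_prod_beta)
  finally show ?thesis .
qed

lemma nn_integral_lborel_pair:
  fixes h :: "'a::euclidean_space \<times> 'b::euclidean_space \<Rightarrow> ennreal"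
  assumes "h \<in> borel_measurable borel"
  shows "(\<integral>\<^sup>+z. h z \<partial>lborel) = (\<integral>\<^sup>+s. \<integral>\<^sup>+r. h (s, r) \<partial>lborel \<partial>lborel)"
    and "(\<integral>\<^sup>+z. h z \<partial>lborel) = (\<integral>\<^sup>+r. \<integral>\<^sup>+s. h (s, r) \<partial>lborel \<partial>lborel)"
    and "(\<lambda>s. \<integral>\<^sup>+r. h (s, r) \<partial>lborel) \<in> borel_measurable borel"
proof -
  have h: "h \<in> borel_measurable (lborel \<Otimes>\<^sub>M lborel)"
    using assms by (simp add: lborel_prod)
  show "(\<integral>\<^sup>+z. h z \<partial>lborel) = (\<integral>\<^sup>+s. \<integral>\<^sup>+r. h (s, r) \<partial>lborel \<partial>lborel)"
    using lborel.nn_integral_fst[OF h] by (simp add: lborel_prod)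
  show "(\<integral>\<^sup>+z. h z \<partial>lborel) = (\<integral>\<^sup>+r. \<integral>\<^sup>+s. h (s, r) \<partial>lborel \<partial>lborel)"
    using lborel_pair.nn_integral_snd[OF h] by (simp add: lborel_prod)
  show "(\<lambda>s. \<integral>\<^sup>+r. h (s, r) \<partial>lborel) \<in> borel_measurable borel"
    using lborel.borel_measurable_nn_integral_fst[OF h] by simp
qed

lemma nn_integral_lborel_stretch:
  fixes h :: "real \<times> real \<Rightarrow> ennreal"
  assumes h: "h \<in> borel_measurable borel" and c: "c > 0"
  shows "(\<integral>\<^sup>+z. h z \<partial>lborel) = ennreal c * (\<integral>\<^sup>+z. h (c * fst z + b, snd z) \<partial>lborel)"
proof -
  have "(\<lambda>z. (c * fst z + b, snd z)) \<in> borel_measurable borel"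
    by (intro borel_measurable_continuous_onI continuous_intros)
  then have h': "(\<lambda>z. h (c * fst z + b, snd z)) \<in> borel_measurable borel"
    by (rule measurable_compose[OF _ h])
  show ?thesis
    unfolding nn_integral_lborel_pair(1)[OF h] nn_integral_lborel_pair(1)[OF h']
    using nn_integral_real_affine[OF nn_integral_lborel_pair(3)[OF h], of c b] c
    by (simp add: add.commute)
qed

text \<open>The plane contains the stretched direction and is mapped to itself; in its parameters
  the stretch is \<open>(s, r) \<mapsto> (c * s + b, r)\<close>, with Jacobian
  \<open>c\<close>.\<close>

lemma planes_measure_stretch:
  assumes c: "c > 0" and p: "fst p = 0" and w: "fst w = 0"
  shows "planes_measure {p} (1, 0, 0) w = density (distr (planes_measure {p} (1, 0, 0) w)
     (planes_measure {p} (1, 0, 0) w) (stretch c b)) (\<lambda>_. ennreal c)" (is "?M = _")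
proof (rule scaled_distrI)
  have T: "stretch c b \<in> borel_measurable borel"
    by (intro borel_measurable_continuous_onI continuous_on_stretch)
  then show "stretch c b \<in> measurable ?M ?M" by simp
  fix f :: "pt \<Rightarrow> ennreal" assume "f \<in> borel_measurable ?M"
  then have f: "f \<in> borel_measurable borel" by simp
  have "stretch c b (p + s *\<^sub>R (1, 0, 0) + r *\<^sub>R w)
      = p + (c * s + b) *\<^sub>R (1, 0, 0) + r *\<^sub>R w" for s r
    using p w by (cases p; cases w) (simp add: stretch_def)
  then show "(\<integral>\<^sup>+x. f x \<partial>?M) = ennreal c * (\<integral>\<^sup>+x. f (stretch c b x) \<partial>?M)"
    using nn_integral_lborel_stretch[OF measurable_compose[OF borel_measurable_plane f] c, of p "(1, 0, 0)" w b]
    by (simp add: nn_integral_planes_measure f measurable_compose[OF T f] ac_simps)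
qed

text \<open>Here the stretch only moves the base points and keeps the parameters
  \<open>(s, r)\<close>. It is injective, so distinct base points stay distinct and the sum over the
  planes is merely reindexed.\<close>

lemma planes_measure_stretch_transversal:
  assumes c: "c > 0" and P: "finite P" and vw: "fst v = 0" "fst w = 0"
  shows "planes_measure (stretch c b ` P) v w = density (distr (planes_measure P v w)
     (planes_measure (stretch c b ` P) v w) (stretch c b)) (\<lambda>_. ennreal 1)" (is "?N = density (distr ?M _ _) _")
proof (rule scaled_distrI)
  have T: "stretch c b \<in> borel_measurable borel"
    by (intro borel_measurable_continuous_onI continuous_on_stretch)
  then show "stretch c b \<in> measurable ?M ?N" by simp
  fix f :: "pt \<Rightarrow> ennreal" assume "f \<in> borel_measurable ?N"
  then have f: "f \<in> borel_measurable borel" by simp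
  have "stretch c b (p + s *\<^sub>R v + r *\<^sub>R w) = stretch c b p + s *\<^sub>R v + r *\<^sub>R w" for p s r
    using vw by (cases p; cases v; cases w) (simp add: stretch_def)
  moreover have "inj_on (stretch c b) P"
    by (rule inj_on_subset[OF bij_is_inj[OF bij_stretch] subset_UNIV]) (use c in auto)
  ultimately show "(\<integral>\<^sup>+x. f x \<partial>?N) = ennreal 1 * (\<integral>\<^sup>+x. f (stretch c b x) \<partial>?M)"
    using P by (simp add: nn_integral_planes_measure f measurable_compose[OF T f] sum.reindex)
qed

definition face_scale :: "real \<Rightarrow> nat \<Rightarrow> real" where
  "face_scale c i = (if i = 0 then 1 else c)"

lemma nat_less_4_cases:
  assumes "i < (4::nat)" obtains "i = 0" | "i = 1" | "i = 2" | "i = 3"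
  using assms by linarith

text \<open>For \<open>i = 0\<close> the carrying planes are read off from the set itself.
  Finiteness of its first coordinates makes them finitely many, and integration over them a finite
  sum.\<close>

lemma surface_measure_stretch:
  assumes c: "c > 0" and i: "i < 4" and \<Gamma>: "\<Gamma> \<in> sets borel" "i = 0 \<Longrightarrow> finite (fst ` \<Gamma>)"
  shows "stretch c b \<in> measurable (surface_measure i \<Gamma>) (surface_measure i (stretch c b ` \<Gamma>))"
    and "surface_measure i (stretch c b ` \<Gamma>) = density (distr (surface_measure i \<Gamma>)
      (surface_measure i (stretch c b ` \<Gamma>)) (stretch c b)) (\<lambda>_. ennreal (face_scale c i))"
proof -
  have inj: "inj (stretch c b)"
    using c bij_stretch[of c b] by (simp add: bij_is_inj)
  have T: "stretch c b \<in> borel_measurable borel"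
    by (intro borel_measurable_continuous_onI continuous_on_stretch)
  have im: "stretch c b ` \<Gamma> \<in> sets borel"
    by (rule stretch_image_borel[OF c \<Gamma>(1)])
  have fst: "(\<lambda>c. (c, 0, 0)) ` fst ` stretch c b ` \<Gamma> = stretch c b ` (\<lambda>c. (c, 0, 0)) ` fst ` \<Gamma>"
    by (force simp: image_image stretch_def)
  obtain M N where MN: "surface_measure i \<Gamma> = restrict_space M \<Gamma>"
      "surface_measure i (stretch c b ` \<Gamma>) = restrict_space N (stretch c b ` \<Gamma>)"
    and M: "sets M = sets borel" and N: "sets N = sets borel"
    and eq: "N = density (distr M N (stretch c b)) (\<lambda>_. ennreal (face_scale c i))"
  proof (cases rule: nat_less_4_cases[OF i])
    case 1
    show ?thesis
      by (rule that[of "planes_measure ((\<lambda>c. (c, 0, 0)) ` fst ` \<Gamma>) (0, 1, 0) (0, 0, 1)"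
            "planes_measure (stretch c b ` (\<lambda>c. (c, 0, 0)) ` fst ` \<Gamma>) (0, 1, 0) (0, 0, 1)"])
        (simp add: surface_measure_def fst 1, simp add: surface_measure_def fst 1, simp, simp,
         simp only: 1 face_scale_def if_True refl,
         rule planes_measure_stretch_transversal[OF c], use \<Gamma>(2)[OF 1] in auto)
  next
    case 2
    show ?thesis
      by (rule that[of "planes_measure {(0, 0, 0)} (1, 0, 0) (0, 0, 1)" "planes_measure {(0, 0, 0)} (1, 0, 0) (0, 0, 1)"])
        (auto simp add: surface_measure_def 2 face_scale_def intro!: planes_measure_stretch c)
  next
    case 3
    show ?thesis
      by (rule that[of "planes_measure {(0, 0, 0)} (1, 0, 0) (0, 1, 0)" "planes_measure {(0, 0, 0)} (1, 0, 0) (0, 1, 0)"])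
        (auto simp add: surface_measure_def 3 face_scale_def intro!: planes_measure_stretch c)
  next
    case 4
    show ?thesis
      by (rule that[of "planes_measure {(0, 0, 1)} (1, 0, 0) (0, 1, -1)" "planes_measure {(0, 0, 1)} (1, 0, 0) (0, 1, -1)"])
        (auto simp add: surface_measure_def 4 face_scale_def intro!: planes_measure_stretch c)
  qed
  have T': "stretch c b \<in> measurable M N"
    using T M N by (simp cong: measurable_cong_sets)
  have sp: "space M = UNIV" using sets_eq_imp_space_eq[OF M] by simp
  show "stretch c b \<in> measurable (surface_measure i \<Gamma>) (surface_measure i (stretch c b ` \<Gamma>))"
    unfolding MN using restrict_space_scaled_distr(1)[OF T' eq inj sp] \<Gamma>(1) im M N by simp
  show "surface_measure i (stretch c b ` \<Gamma>) = density (distr (surface_measure i \<Gamma>)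
      (surface_measure i (stretch c b ` \<Gamma>)) (stretch c b)) (\<lambda>_. ennreal (face_scale c i))"
    unfolding MN using restrict_space_scaled_distr(2)[OF T' eq inj sp] \<Gamma>(1) im M N by simp
qed

lemma surface_measure_borel: "i < 4 \<Longrightarrow> (\<lambda>x. x) \<in> measurable (surface_measure i \<Gamma>) borel"
  unfolding surface_measure_def
  by (erule nat_less_4_cases) (auto intro!: measurable_restrict_space1 cong: measurable_cong_sets)

section \<open>The reference prism\<close>

text \<open>Exhibits the triangle as the standard simplex of the plane, whose hull and interior are
  known by inequalities.\<close>

lemma ref_triangle_vertices: "{(0, 0), (1, 0), (0, 1)} = insert 0 (Basis :: (real \<times> real) set)"
  by (auto simp: Basis_prod_def zero_prod_def)

lemma Basis_real_pair: "(Basis :: (real \<times> real) set) = {(1, 0), (0, 1)}"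
  by (auto simp: Basis_prod_def zero_prod_def)

lemma ref_triangle_hull:
  "convex hull {(0, 0), (1, 0), (0, 1)} = {(y1, y2). 0 \<le> y1 \<and> 0 \<le> y2 \<and> y1 + y2 \<le> (1::real)}"
  unfolding ref_triangle_vertices std_simplex unfolding Basis_real_pair by auto

lemma ref_triangle_eq: "ref_triangle = {(y1, y2). 0 < y1 \<and> 0 < y2 \<and> y1 + y2 < 1}"
  unfolding ref_triangle_def ref_triangle_vertices interior_std_simplex unfolding Basis_real_pair by auto

lemma closure_ref_triangle: "closure ref_triangle = {(y1, y2). 0 \<le> y1 \<and> 0 \<le> y2 \<and> y1 + y2 \<le> 1}"
proof -
  let ?S = "convex hull {(0, 0), (1, 0), (0, 1)} :: (real \<times> real) set"
  have "(1/4, 1/4) \<in> interior ?S"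
    using ref_triangle_eq unfolding ref_triangle_def by auto
  then have "closure (interior ?S) = closure ?S"
    by (intro convex_closure_interior convex_convex_hull) auto
  also have "\<dots> = ?S"
    by (intro closure_closed compact_imp_closed finite_imp_compact_convex_hull) auto
  finally show ?thesis by (simp only: ref_triangle_def ref_triangle_hull)
qed

lemma open_prism: "open (prism a b)"
  unfolding prism_def ref_triangle_def by (intro open_Times) auto

lemma closure_ref_prism:
  "(x0, x1, x2) \<in> closure ref_prism \<longleftrightarrow> - 1 \<le> x0 \<and> x0 \<le> 1 \<and> 0 \<le> x1 \<and> 0 \<le> x2 \<and> x1 + x2 \<le> 1"
  by (auto simp: prism_def closure_Times closure_ref_triangle)

lemma convex_prism: "convex (prism a b)"
  unfolding prism_def ref_triangle_def by (intro convex_Times convex_interior convex_convex_hull) auto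

lemma compact_closure_ref_prism: "compact (closure ref_prism)"
proof -
  have "bounded ref_prism"
    unfolding prism_def ref_triangle_def
    by (intro bounded_Times bounded_interior finite_imp_bounded_convex_hull) auto
  then show ?thesis by simp
qed

lemma AE_closure_prism_iff: "AE x in lebesgue. x \<in> closure (prism a b) \<longleftrightarrow> x \<in> prism a b"
proof -
  have "AE x in lebesgue. x \<notin> frontier (prism a b)"
    using negligible_convex_frontier[OF convex_prism[of a b]] unfolding negligible_iff_null_sets
    by (rule AE_not_in)
  then show ?thesis
    by eventually_elim (use open_prism[of a b] closure_subset[of "prism a b"] in
        \<open>auto simp: frontier_def interior_open\<close>)
qed

text \<open>Chords that start at a face point lie in the closed prism, whereas the volume norms
  belong to the open one. The frontier of a convex set is negligible, so the two integrals
  agree.\<close>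

lemma nn_integral_closure_prism:
  assumes f: "f \<in> borel_measurable borel"
  shows "(\<integral>\<^sup>+x. f x * indicator (closure (prism a b)) x \<partial>lborel) = (\<integral>\<^sup>+x. f x \<partial>lebesgue_on (prism a b))"
proof -
  have "(\<integral>\<^sup>+x. f x * indicator (closure (prism a b)) x \<partial>lborel)
      = (\<integral>\<^sup>+x. f x * indicator (closure (prism a b)) x \<partial>lebesgue)"
    by (rule nn_integral_completion[symmetric])
  also have "\<dots> = (\<integral>\<^sup>+x. f x * indicator (prism a b) x \<partial>lebesgue)"
  proof (rule nn_integral_cong_AE)
    show "AE x in lebesgue. f x * indicator (closure (prism a b)) x = f x * indicator (prism a b) x"
      using AE_closure_prism_iff[of a b] by eventually_elim (simp add: indicator_def)
  qed
  also have "\<dots> = (\<integral>\<^sup>+x. f x \<partial>lebesgue_on (prism a b))"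
    using open_prism[of a b] by (subst nn_integral_restrict_space) auto
  finally show ?thesis .
qed

lemma mem_ref_boundary:
  "(x0, x1, x2) \<in> ref_boundary 0 \<longleftrightarrow> (x0, x1, x2) \<in> closure ref_prism \<and> (x0 = - 1 \<or> x0 = 1)"
  "(x0, x1, x2) \<in> ref_boundary 1 \<longleftrightarrow> (x0, x1, x2) \<in> closure ref_prism \<and> x1 = 0"
  "(x0, x1, x2) \<in> ref_boundary 2 \<longleftrightarrow> (x0, x1, x2) \<in> closure ref_prism \<and> x2 = 0"
  "(x0, x1, x2) \<in> ref_boundary 3 \<longleftrightarrow> (x0, x1, x2) \<in> closure ref_prism \<and> x1 + x2 = 1"
  by (auto simp: ref_boundary_def)

lemma ref_boundary_subset: "i < 4 \<Longrightarrow> ref_boundary i \<subseteq> closure ref_prism"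
  by (erule nat_less_4_cases) (auto simp only: mem_ref_boundary split_paired_All subset_iff)

lemma compact_ref_boundary:
  assumes "i < 4" shows "compact (ref_boundary i)"
proof -
  have eq: "ref_boundary 0 = closure ref_prism \<inter> ({x. fst x = - 1} \<union> {x. fst x = 1})"
    "ref_boundary 1 = closure ref_prism \<inter> {x. fst (snd x) = 0}"
    "ref_boundary 2 = closure ref_prism \<inter> {x. snd (snd x) = 0}"
    "ref_boundary 3 = closure ref_prism \<inter> {x. fst (snd x) + snd (snd x) = 1}"
    by (auto simp add: mem_ref_boundary simp del: One_nat_def)
  show ?thesis
    by (cases rule: nat_less_4_cases[OF assms]; simp only: eq;
        intro compact_Int_closed compact_closure_ref_prism closed_Un closed_Collect_eq continuous_intros)
qed

lemma ref_boundary_borel: "i < 4 \<Longrightarrow> ref_boundary i \<in> sets borel"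
  by (intro borel_closed compact_imp_closed compact_ref_boundary)

lemma fst_ref_boundary_0: "fst ` ref_boundary 0 = {- 1, 1}"
proof -
  have "(- 1, 0, 0) \<in> ref_boundary 0" "(1, 0, 0) \<in> ref_boundary 0"
    by (simp_all add: mem_ref_boundary closure_ref_prism)
  then have "{- 1, 1} \<subseteq> fst ` ref_boundary 0" by force
  moreover have "fst ` ref_boundary 0 \<subseteq> {- 1, 1}" by (auto simp: mem_ref_boundary)
  ultimately show ?thesis by (rule subset_antisym[rotated])
qed

section \<open>Trace inequality\<close>

text \<open>Since the derivative of \<open>f\<^sup>2\<close> is at most
  \<open>f\<^sup>2 + f'\<^sup>2\<close> in absolute value, the values of \<open>f\<^sup>2\<close> at
  two points differ by at most the integral on the right. Integrating this over the second point
  gives the constant \<open>1 + (b - a) \<le> 3\<close>; the bound 2 on the length is attained by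
  the chords in direction \<open>x0\<close>. The factor \<open>b - a\<close> keeps the estimate
  valid for degenerate intervals.\<close>

lemma interval_trace_inequality:
  fixes f f' :: "real \<Rightarrow> real"
  assumes f: "\<And>t. (f has_real_derivative f' t) (at t)" and f': "continuous_on UNIV f'"
    and x: "a \<le> x" "x \<le> b" and ab: "b - a \<le> 2"
  shows "(b - a) * (f x)\<^sup>2 \<le> 3 * integral {a..b} (\<lambda>t. (f t)\<^sup>2 + (f' t)\<^sup>2)"
proof -
  let ?h = "\<lambda>t. (f t)\<^sup>2 + (f' t)\<^sup>2"
  let ?J = "integral {a..b} ?h"
  have contf: "continuous_on S f" for S
    using f by (meson DERIV_isCont continuous_at_imp_continuous_on)
  have contf': "continuous_on S f'" for S
    using f' by (rule continuous_on_subset) auto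
  have int_h: "?h integrable_on {y..z}" for y z
    by (intro integrable_continuous_interval continuous_intros contf contf')
  have diff: "\<bar>(f z)\<^sup>2 - (f y)\<^sup>2\<bar> \<le> ?J" if "a \<le> y" "y \<le> z" "z \<le> b" for y z
  proof -
    have ftc: "((\<lambda>t. 2 * f t * f' t) has_integral ((f z)\<^sup>2 - (f y)\<^sup>2)) {y..z}"
    proof (rule fundamental_theorem_of_calculus[OF that(2)])
      fix t
      have "((\<lambda>t. (f t)\<^sup>2) has_real_derivative 2 * f t * f' t) (at t)"
        by (auto intro!: derivative_eq_intros f)
      then show "((\<lambda>t. (f t)\<^sup>2) has_vector_derivative 2 * f t * f' t) (at t within {y..z})"
        by (simp add: has_real_derivative_iff_has_vector_derivative has_vector_derivative_at_within)
    qed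
    have bound: "2 * f t * f' t \<le> ?h t" "- (2 * f t * f' t) \<le> ?h t" for t
      using zero_le_power2[of "f t - f' t"] zero_le_power2[of "f t + f' t"]
      by (simp_all add: power2_eq_square algebra_simps)
    have "(f z)\<^sup>2 - (f y)\<^sup>2 \<le> integral {y..z} ?h"
      by (rule has_integral_le[OF ftc integrable_integral[OF int_h]]) (rule bound(1))
    moreover have "- ((f z)\<^sup>2 - (f y)\<^sup>2) \<le> integral {y..z} ?h"
      by (rule has_integral_le[OF has_integral_neg[OF ftc] integrable_integral[OF int_h]]) (rule bound(2))
    moreover have "integral {y..z} ?h \<le> ?J"
      using that by (intro integral_subset_le int_h) auto
    ultimately show ?thesis by linarith
  qed
  have point: "(f x)\<^sup>2 \<le> (f y)\<^sup>2 + ?J" if "y \<in> {a..b}" for y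
    using diff[of x y] diff[of y x] x that by (cases "x \<le> y") auto
  have int_f: "(\<lambda>y. (f y)\<^sup>2) integrable_on {a..b}"
    by (intro integrable_continuous_interval continuous_intros contf)
  have "(b - a) * (f x)\<^sup>2 = integral {a..b} (\<lambda>y. (f x)\<^sup>2)"
    using x by simp
  also have "\<dots> \<le> integral {a..b} (\<lambda>y. (f y)\<^sup>2 + ?J)"
    using int_f point by (intro integral_le integrable_add) auto
  also have "\<dots> = integral {a..b} (\<lambda>y. (f y)\<^sup>2) + (b - a) * ?J"
    using int_f x by (subst integral_add) auto
  also have "\<dots> \<le> ?J + 2 * ?J"
  proof (rule add_mono)
    show "integral {a..b} (\<lambda>y. (f y)\<^sup>2) \<le> ?J"
      by (intro integral_le int_f int_h) simp
    have "0 \<le> ?J" by (intro integral_nonneg int_h) simp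
    then show "(b - a) * ?J \<le> 2 * ?J" by (rule mult_right_mono[OF ab])
  qed
  finally show ?thesis by simp
qed

text \<open>The constant 3 of the one-dimensional estimate is built in, so that the estimate along a
  chord has no constant left.\<close>

definition energy :: "pt \<Rightarrow> (pt \<Rightarrow> real) \<Rightarrow> pt \<Rightarrow> real" where
  "energy e d x = 3 * ((d x)\<^sup>2 + (pderivative e d x)\<^sup>2)"

lemma energy_nonneg: "energy e d x \<ge> 0"
  by (simp add: energy_def)

lemma energy_borel: "smooth d \<Longrightarrow> e \<in> Basis \<Longrightarrow> energy e d \<in> borel_measurable borel"
  unfolding energy_def[abs_def]
  by (intro borel_measurable_continuous_onI continuous_intros smooth_continuous_on smooth_pderivative)

text \<open>The right-hand side integrates over the whole line with an indicator of
  \<open>A\<close>, the shape in which Tonelli can combine all chords into one volume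
  integral.\<close>

lemma slice_trace_inequality:
  assumes d: "smooth d" and e: "e \<in> Basis" and x: "a \<le> x" "x \<le> b" and ab: "b - a \<le> 2"
    and A: "\<And>t. a \<le> t \<Longrightarrow> t \<le> b \<Longrightarrow> y + t *\<^sub>R e \<in> A"
  shows "ennreal ((b - a) * (d (y + x *\<^sub>R e))\<^sup>2)
    \<le> (\<integral>\<^sup>+t. ennreal (energy e d (y + t *\<^sub>R e)) * indicator A (y + t *\<^sub>R e) \<partial>lborel)"
proof -
  have line: "continuous_on S (\<lambda>t. y + t *\<^sub>R e)" for S by (intro continuous_intros)
  have cont: "continuous_on UNIV (\<lambda>t. d (y + t *\<^sub>R e))" "continuous_on UNIV (\<lambda>t. pderivative e d (y + t *\<^sub>R e))"
    by (rule continuous_on_compose2[OF smooth_continuous_on[of _ UNIV] line];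
        simp add: d smooth_pderivative e)+
  have conte: "continuous_on S (\<lambda>t. energy e d (y + t *\<^sub>R e))" for S
    unfolding energy_def by (intro continuous_intros continuous_on_subset[OF cont(1)] continuous_on_subset[OF cont(2)]) auto
  have "(b - a) * (d (y + x *\<^sub>R e))\<^sup>2
      \<le> 3 * integral {a..b} (\<lambda>t. (d (y + t *\<^sub>R e))\<^sup>2 + (pderivative e d (y + t *\<^sub>R e))\<^sup>2)"
    by (rule interval_trace_inequality[OF _ cont(2) x ab])
       (rule has_real_derivative_along_line[OF smooth_differentiable[OF d]])
  also have "\<dots> = integral {a..b} (\<lambda>t. energy e d (y + t *\<^sub>R e))"
    by (simp only: energy_def integral_mult_right)
  finally have "ennreal ((b - a) * (d (y + x *\<^sub>R e))\<^sup>2)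
      \<le> ennreal (integral {a..b} (\<lambda>t. energy e d (y + t *\<^sub>R e)))"
    by (rule ennreal_leI)
  also have "\<dots> = (\<integral>\<^sup>+t. ennreal (indicator {a..b} t * energy e d (y + t *\<^sub>R e)) \<partial>lborel)"
    by (rule nn_integral_has_integral_lebesgue[symmetric])
      (intro conte energy_nonneg integrable_integral integrable_continuous_interval)+
  also have "\<dots> \<le> (\<integral>\<^sup>+t. ennreal (energy e d (y + t *\<^sub>R e)) * indicator A (y + t *\<^sub>R e) \<partial>lborel)"
    by (rule nn_integral_mono) (use A in \<open>auto simp: indicator_def\<close>)
  finally show ?thesis .
qed

text \<open>One order of integration per face: \<open>z\<close> carries the parameters of the face
  and \<open>t\<close> runs along the chord. The last one contains a reflection because the points
  of the slanted face are parametrized as \<open>(s, r, 1 - r)\<close>.\<close>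

lemma nn_integral_pt_slices:
  fixes g :: "pt \<Rightarrow> ennreal"
  assumes g: "g \<in> borel_measurable borel"
  shows "(\<integral>\<^sup>+z. \<integral>\<^sup>+t. g (t, fst z, snd z) \<partial>lborel \<partial>lborel) = (\<integral>\<^sup>+x. g x \<partial>lborel)"
    and "(\<integral>\<^sup>+z. \<integral>\<^sup>+t. g (fst z, t, snd z) \<partial>lborel \<partial>lborel) = (\<integral>\<^sup>+x. g x \<partial>lborel)"
    and "(\<integral>\<^sup>+z. \<integral>\<^sup>+t. g (fst z, snd z, t) \<partial>lborel \<partial>lborel) = (\<integral>\<^sup>+x. g x \<partial>lborel)"
    and "(\<integral>\<^sup>+z. \<integral>\<^sup>+t. g (fst z, t, 1 - snd z) \<partial>lborel \<partial>lborel) = (\<integral>\<^sup>+x. g x \<partial>lborel)"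
proof -
  have comp: "(\<lambda>y. g (F y)) \<in> borel_measurable borel" if "continuous_on UNIV F" for F :: "'b::topological_space \<Rightarrow> pt"
    by (rule measurable_compose[OF borel_measurable_continuous_onI[OF that] g])
  have meas1: "(\<lambda>z. g (s, z)) \<in> borel_measurable borel" for s
    by (intro comp continuous_intros)
  have meas: "(\<lambda>z. \<integral>\<^sup>+t. g (fst z, t, snd z) \<partial>lborel) \<in> borel_measurable borel"
      "(\<lambda>z. \<integral>\<^sup>+t. g (fst z, snd z, t) \<partial>lborel) \<in> borel_measurable borel"
    using nn_integral_lborel_pair(3)[of "\<lambda>q. g (fst (fst q), snd q, snd (fst q))"]
      nn_integral_lborel_pair(3)[of "\<lambda>q. g (fst (fst q), snd (fst q), snd q)"]
    by (simp_all add: comp continuous_intros)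
  show "(\<integral>\<^sup>+z. \<integral>\<^sup>+t. g (t, fst z, snd z) \<partial>lborel \<partial>lborel) = (\<integral>\<^sup>+x. g x \<partial>lborel)"
    by (simp add: nn_integral_lborel_pair(2)[OF g])
  show 2: "(\<integral>\<^sup>+z. \<integral>\<^sup>+t. g (fst z, t, snd z) \<partial>lborel \<partial>lborel) = (\<integral>\<^sup>+x. g x \<partial>lborel)"
    by (simp add: nn_integral_lborel_pair(1)[OF g] nn_integral_lborel_pair(1)[OF meas(1)]
        nn_integral_lborel_pair(2)[OF meas1])
  show "(\<integral>\<^sup>+z. \<integral>\<^sup>+t. g (fst z, snd z, t) \<partial>lborel \<partial>lborel) = (\<integral>\<^sup>+x. g x \<partial>lborel)"
    by (simp add: nn_integral_lborel_pair(1)[OF g] nn_integral_lborel_pair(1)[OF meas(2)]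
        nn_integral_lborel_pair(1)[OF meas1])
  have "(\<integral>\<^sup>+z. \<integral>\<^sup>+t. g (fst z, t, 1 - snd z) \<partial>lborel \<partial>lborel)
      = (\<integral>\<^sup>+s. \<integral>\<^sup>+r. \<integral>\<^sup>+t. g (s, t, 1 - r) \<partial>lborel \<partial>lborel \<partial>lborel)"
    using nn_integral_lborel_pair(1)[OF measurable_compose[OF _ meas(1), of "\<lambda>z. (fst z, 1 - snd z)"]]
    by (simp add: borel_measurable_continuous_onI continuous_intros)
  also have "\<dots> = (\<integral>\<^sup>+s. \<integral>\<^sup>+r. \<integral>\<^sup>+t. g (s, t, r) \<partial>lborel \<partial>lborel \<partial>lborel)"
  proof (rule nn_integral_cong)
    fix s
    have "(\<lambda>r. \<integral>\<^sup>+t. g (s, t, r) \<partial>lborel) \<in> borel_measurable borel"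
      using measurable_compose[OF _ meas(1), of "\<lambda>r. (s, r)"]
      by (simp add: borel_measurable_continuous_onI continuous_intros)
    from nn_integral_real_affine[OF this, of "-1" 1]
    show "(\<integral>\<^sup>+r. \<integral>\<^sup>+t. g (s, t, 1 - r) \<partial>lborel \<partial>lborel) = (\<integral>\<^sup>+r. \<integral>\<^sup>+t. g (s, t, r) \<partial>lborel \<partial>lborel)"
      by simp
  qed
  also have "\<dots> = (\<integral>\<^sup>+z. \<integral>\<^sup>+t. g (fst z, t, snd z) \<partial>lborel \<partial>lborel)"
    by (simp add: nn_integral_lborel_pair(1)[OF meas(1)])
  finally show "(\<integral>\<^sup>+z. \<integral>\<^sup>+t. g (fst z, t, 1 - snd z) \<partial>lborel \<partial>lborel) = (\<integral>\<^sup>+x. g x \<partial>lborel)"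
    using 2 by simp
qed

text \<open>The Gram factor is 1 for faces spanned by coordinate vectors. On the slanted face the
  spanning vectors \<open>(1, 0, 0)\<close> and \<open>(0, 1, - 1)\<close> are orthogonal of lengths
  1 and \<open>sqrt 2\<close>.\<close>

lemma nn_integral_surface_measure:
  fixes f :: "pt \<Rightarrow> ennreal"
  assumes f: "f \<in> borel_measurable borel"
  defines "F \<equiv> \<lambda>i x. f x * indicator (ref_boundary i) x"
  shows "(\<integral>\<^sup>+x. f x \<partial>surface_measure 0 (ref_boundary 0))
      = (\<integral>\<^sup>+z. F 0 (- 1, fst z, snd z) \<partial>lborel) + (\<integral>\<^sup>+z. F 0 (1, fst z, snd z) \<partial>lborel)"
    and "(\<integral>\<^sup>+x. f x \<partial>surface_measure 1 (ref_boundary 1)) = (\<integral>\<^sup>+z. F 1 (fst z, 0, snd z) \<partial>lborel)"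
    and "(\<integral>\<^sup>+x. f x \<partial>surface_measure 2 (ref_boundary 2)) = (\<integral>\<^sup>+z. F 2 (fst z, snd z, 0) \<partial>lborel)"
    and "(\<integral>\<^sup>+x. f x \<partial>surface_measure 3 (ref_boundary 3))
      = ennreal (sqrt 2) * (\<integral>\<^sup>+z. F 3 (fst z, snd z, 1 - snd z) \<partial>lborel)"
proof -
  have F: "F i \<in> borel_measurable borel" if "i < 4" for i
    unfolding F_def using f ref_boundary_borel[OF that]
    by (intro borel_measurable_times_ennreal borel_measurable_indicator) auto
  have restrict: "(\<integral>\<^sup>+x. f x \<partial>restrict_space (planes_measure P v w) (ref_boundary i))
      = gram v w * (\<Sum>p\<in>P. \<integral>\<^sup>+z. F i (p + fst z *\<^sub>R v + snd z *\<^sub>R w) \<partial>lborel)"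
    if "i < 4" "finite P" for i P v w
    using ref_boundary_borel[OF that(1)] nn_integral_planes_measure[OF that(2) F[OF that(1)]]
    by (subst nn_integral_restrict_space) (auto simp: F_def)
  show "(\<integral>\<^sup>+x. f x \<partial>surface_measure 0 (ref_boundary 0))
      = (\<integral>\<^sup>+z. F 0 (- 1, fst z, snd z) \<partial>lborel) + (\<integral>\<^sup>+z. F 0 (1, fst z, snd z) \<partial>lborel)"
    by (simp add: surface_measure_def fst_ref_boundary_0 restrict gram_def)
  show "(\<integral>\<^sup>+x. f x \<partial>surface_measure 1 (ref_boundary 1)) = (\<integral>\<^sup>+z. F 1 (fst z, 0, snd z) \<partial>lborel)"
    using restrict[of 1] by (simp add: surface_measure_def gram_def)
  show "(\<integral>\<^sup>+x. f x \<partial>surface_measure 2 (ref_boundary 2)) = (\<integral>\<^sup>+z. F 2 (fst z, snd z, 0) \<partial>lborel)"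
    by (simp add: surface_measure_def restrict gram_def)
  show "(\<integral>\<^sup>+x. f x \<partial>surface_measure 3 (ref_boundary 3))
      = ennreal (sqrt 2) * (\<integral>\<^sup>+z. F 3 (fst z, snd z, 1 - snd z) \<partial>lborel)"
    by (simp add: surface_measure_def restrict gram_def)
qed

text \<open>On the slanted face the direction is transversal rather than normal: a coordinate
  direction suffices for the chord argument and keeps the derivative a single partial derivative
  controlled in the space used for that face.\<close>

definition face_dir :: "nat \<Rightarrow> pt" where
  "face_dir i = [(1, 0, 0), (0, 1, 0), (0, 0, 1), (0, 1, 0)] ! i"

text \<open>
  The weight of a point on face \<open>i\<close> is the length of the chord of the prism through it in direction
  \<open>face_dir i\<close>; it degenerates at the edges, where the chord shrinks to a point.
\<close>

definition face_weight :: "nat \<Rightarrow> pt \<Rightarrow> real" where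
  "face_weight i = (\<lambda>(x0, x1, x2). [2, 1 - x2, 1 - x1, x1] ! i)"

lemma face_dir_Basis: "i < 4 \<Longrightarrow> face_dir i \<in> Basis"
  by (erule nat_less_4_cases) (simp_all add: face_dir_def Basis_pt)

lemma face_weight_borel: "i < 4 \<Longrightarrow> face_weight i \<in> borel_measurable borel"
  by (erule nat_less_4_cases)
     (simp_all add: face_weight_def case_prod_beta borel_measurable_continuous_onI continuous_intros)

lemma face_weight_bounds:
  assumes "i < 4" "x \<in> ref_boundary i" shows "0 \<le> face_weight i x" "face_weight i x \<le> 2"
  using ref_boundary_subset[OF assms(1)] assms(2)
  by (cases x; cases rule: nat_less_4_cases[OF assms(1)]; force simp: face_weight_def closure_ref_prism)+

text \<open>The estimates along the chords are integrated over the face parameters, and the chords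
  fill the prism. The factor 2 counts the two faces for \<open>i = 0\<close>, absorbs
  \<open>sqrt 2\<close> for \<open>i = 3\<close>, and is generous otherwise.\<close>

lemma nn_trace_inequality:
  assumes i: "i < 4" and d: "smooth d"
  shows "(\<integral>\<^sup>+x. ennreal (face_weight i x * (d x)\<^sup>2) \<partial>surface_measure i (ref_boundary i))
    \<le> 2 * (\<integral>\<^sup>+x. ennreal (energy (face_dir i) d x) \<partial>lebesgue_on ref_prism)"
proof -
  let ?e = "face_dir i"
  let ?g = "\<lambda>x. ennreal (energy ?e d x) * indicator (closure ref_prism) x"
  let ?f = "\<lambda>x. ennreal (face_weight i x * (d x)\<^sup>2)"
  have e: "?e \<in> Basis" by (rule face_dir_Basis[OF i])
  have en: "(\<lambda>x. ennreal (energy ?e d x)) \<in> borel_measurable borel"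
    using energy_borel[OF d e] by simp
  have g: "?g \<in> borel_measurable borel"
    using en by (intro borel_measurable_times_ennreal borel_measurable_indicator) auto
  have f: "?f \<in> borel_measurable borel"
    using face_weight_borel[OF i] smooth_borel_measurable[OF d] by simp
  have total: "(\<integral>\<^sup>+x. ?g x \<partial>lborel) = (\<integral>\<^sup>+x. ennreal (energy ?e d x) \<partial>lebesgue_on ref_prism)"
    by (rule nn_integral_closure_prism[OF en])
  note slices = nn_integral_pt_slices[OF g, unfolded total]
  note bound = slice_trace_inequality[OF d e, where A = "closure ref_prism"]
  show ?thesis
  proof (cases rule: nat_less_4_cases[OF i])
    case 1
    have *: "?f (c, s, r) * indicator (ref_boundary 0) (c, s, r)
        \<le> (\<integral>\<^sup>+t. ?g (t, s, r) \<partial>lborel)" if "c = - 1 \<or> c = 1" for c s r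
      using bound[of "- 1" c 1 "(0, s, r)"] that
      by (auto simp: 1 face_dir_def face_weight_def mem_ref_boundary closure_ref_prism split: split_indicator)
    have "(\<integral>\<^sup>+z. ?f (c, fst z, snd z) * indicator (ref_boundary 0) (c, fst z, snd z) \<partial>lborel)
        \<le> (\<integral>\<^sup>+x. ennreal (energy ?e d x) \<partial>lebesgue_on ref_prism)" if "c = - 1 \<or> c = 1" for c
      unfolding slices(1)[symmetric] by (rule nn_integral_mono) (rule *[OF that])
    from add_mono[OF this this, of "- 1" 1] show ?thesis
      using nn_integral_surface_measure(1)[OF f] by (simp add: 1 mult_2)
  next
    case 2
    have "?f (fst z, 0, snd z) * indicator (ref_boundary 1) (fst z, 0, snd z)
        \<le> (\<integral>\<^sup>+t. ?g (fst z, t, snd z) \<partial>lborel)" for z :: "real \<times> real"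
      using bound[of 0 0 "1 - snd z" "(fst z, 0, snd z)"]
      by (auto simp: 2 face_dir_def face_weight_def mem_ref_boundary closure_ref_prism
          simp del: One_nat_def split: split_indicator)
    then have "(\<integral>\<^sup>+z. ?f (fst z, 0, snd z) * indicator (ref_boundary 1) (fst z, 0, snd z) \<partial>lborel)
        \<le> (\<integral>\<^sup>+x. ennreal (energy ?e d x) \<partial>lebesgue_on ref_prism)"
      unfolding slices(2)[symmetric] by (intro nn_integral_mono)
    from add_mono[OF this zero_le[of "\<integral>\<^sup>+x. ennreal (energy ?e d x) \<partial>lebesgue_on ref_prism"]]
    show ?thesis
      using nn_integral_surface_measure(2)[OF f] by (simp add: 2 mult_2)
  next
    case 3
    have "?f (fst z, snd z, 0) * indicator (ref_boundary 2) (fst z, snd z, 0)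
        \<le> (\<integral>\<^sup>+t. ?g (fst z, snd z, t) \<partial>lborel)" for z :: "real \<times> real"
      using bound[of 0 0 "1 - snd z" "(fst z, snd z, 0)"]
      by (auto simp: 3 face_dir_def face_weight_def mem_ref_boundary closure_ref_prism split: split_indicator)
    then have "(\<integral>\<^sup>+z. ?f (fst z, snd z, 0) * indicator (ref_boundary 2) (fst z, snd z, 0) \<partial>lborel)
        \<le> (\<integral>\<^sup>+x. ennreal (energy ?e d x) \<partial>lebesgue_on ref_prism)"
      unfolding slices(3)[symmetric] by (intro nn_integral_mono)
    from add_mono[OF this zero_le[of "\<integral>\<^sup>+x. ennreal (energy ?e d x) \<partial>lebesgue_on ref_prism"]]
    show ?thesis
      using nn_integral_surface_measure(3)[OF f] by (simp add: 3 mult_2)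
  next
    case 4
    have "?f (fst z, snd z, 1 - snd z) * indicator (ref_boundary 3) (fst z, snd z, 1 - snd z)
        \<le> (\<integral>\<^sup>+t. ?g (fst z, t, 1 - snd z) \<partial>lborel)" for z :: "real \<times> real"
      \<comment> \<open>The chord starts on the face \<open>x1 = 0\<close> and ends at the point of
        the slanted face, so the evaluation point is its right endpoint.\<close>
      using bound[of 0 "snd z" "snd z" "(fst z, 0, 1 - snd z)"]
      by (auto simp: 4 face_dir_def face_weight_def mem_ref_boundary closure_ref_prism split: split_indicator)
    then have "(\<integral>\<^sup>+z. ?f (fst z, snd z, 1 - snd z) * indicator (ref_boundary 3) (fst z, snd z, 1 - snd z) \<partial>lborel)
        \<le> (\<integral>\<^sup>+x. ennreal (energy ?e d x) \<partial>lebesgue_on ref_prism)"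
      unfolding slices(4)[symmetric] by (intro nn_integral_mono)
    moreover have "ennreal (sqrt 2) \<le> 2"
      using ennreal_leI[of "sqrt 2" 2] real_sqrt_le_mono[of 2 4] by simp
    ultimately show ?thesis
      using nn_integral_surface_measure(4)[OF f] by (simp add: 4 mult_mono)
  qed
qed

section \<open>Uniqueness of traces\<close>

lemma space_surface_measure: "i < 4 \<Longrightarrow> space (surface_measure i \<Gamma>) = \<Gamma>"
  by (erule nat_less_4_cases) (simp_all add: surface_measure_def space_restrict_space)

lemma AE_snd_not_eq: "AE z in lborel. snd (z :: real \<times> real) \<noteq> a"
proof -
  define Z :: "(real \<times> real) set" where "Z = {z. snd z = a}"
  have Z: "Z \<in> sets borel"
    unfolding Z_def by (intro borel_closed closed_Collect_eq continuous_intros)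
  have "emeasure lborel Z = (\<integral>\<^sup>+z. indicator Z z \<partial>lborel)"
    using Z by simp
  also have "\<dots> = (\<integral>\<^sup>+r. \<integral>\<^sup>+s. indicator Z (s, r) \<partial>lborel \<partial>lborel)"
    by (rule nn_integral_lborel_pair(2)) (use Z in simp)
  also have "\<dots> = (\<integral>\<^sup>+r. 0 \<partial>(lborel :: real measure))"
  proof (rule nn_integral_cong_AE)
    show "AE r in lborel. (\<integral>\<^sup>+s. indicator Z (s, r) \<partial>lborel) = 0"
      using AE_lborel_singleton[of a] by eventually_elim (simp add: indicator_def Z_def)
  qed
  finally have "Z \<in> null_sets lborel"
    using Z by (simp add: null_sets_def)
  from AE_not_in[OF this] show ?thesis by (simp add: Z_def)
qed

text \<open>The weight is constantly 2 for \<open>i = 0\<close>. On the other faces its zeros form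
  one line in the parameter plane, where the second parameter is 1, 1 and 0 respectively.\<close>

lemma AE_face_weight_nonzero:
  assumes i: "i < 4" shows "AE x in surface_measure i (ref_boundary i). face_weight i x \<noteq> 0"
proof -
  let ?f = "indicator {x. face_weight i x = 0} :: pt \<Rightarrow> ennreal"
  have Z: "{x. face_weight i x = 0} \<in> sets borel"
    using measurable_sets[OF face_weight_borel[OF i], of "{0}"] by (simp add: vimage_def)
  then have f: "?f \<in> borel_measurable borel" by simp
  have "(\<integral>\<^sup>+x. ?f x \<partial>surface_measure i (ref_boundary i)) = 0"
  proof (cases rule: nat_less_4_cases[OF i])
    case 1
    have "?f x = 0" for x by (cases x) (simp add: 1 face_weight_def)
    then show ?thesis by simp
  next
    case 2
    have "(\<integral>\<^sup>+z. ?f (fst z, 0, snd z) * indicator (ref_boundary 1) (fst z, 0, snd z) \<partial>lborel)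
        = (\<integral>\<^sup>+z. 0 \<partial>(lborel :: (real \<times> real) measure))"
      by (rule nn_integral_cong_AE, use AE_snd_not_eq[of 1] in eventually_elim)
        (simp add: 2 face_weight_def)
    then show ?thesis
      using nn_integral_surface_measure(2)[OF f] by (simp add: 2)
  next
    case 3
    have "(\<integral>\<^sup>+z. ?f (fst z, snd z, 0) * indicator (ref_boundary 2) (fst z, snd z, 0) \<partial>lborel)
        = (\<integral>\<^sup>+z. 0 \<partial>(lborel :: (real \<times> real) measure))"
      by (rule nn_integral_cong_AE, use AE_snd_not_eq[of 1] in eventually_elim)
        (simp add: 3 face_weight_def)
    then show ?thesis
      using nn_integral_surface_measure(3)[OF f] by (simp add: 3)
  next
    case 4
    have "(\<integral>\<^sup>+z. ?f (fst z, snd z, 1 - snd z) * indicator (ref_boundary 3) (fst z, snd z, 1 - snd z) \<partial>lborel)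
        = (\<integral>\<^sup>+z. 0 \<partial>(lborel :: (real \<times> real) measure))"
      by (rule nn_integral_cong_AE, use AE_snd_not_eq[of 0] in eventually_elim)
        (simp add: 4 face_weight_def)
    then show ?thesis
      using nn_integral_surface_measure(4)[OF f] by (simp add: 4)
  qed
  moreover have "?f \<in> borel_measurable (surface_measure i (ref_boundary i))"
    using measurable_compose[OF surface_measure_borel[OF i] f] .
  ultimately have "AE x in surface_measure i (ref_boundary i). ?f x = 0"
    by (simp add: nn_integral_0_iff_AE)
  then show ?thesis by eventually_elim (simp add: indicator_def split: if_splits)
qed

text \<open>Finiteness lets bounded functions on a face, such as restrictions of smooth ones, be
  square integrable.\<close>

lemma finite_surface_measure:
  assumes i: "i < 4"
  shows "finite_measure (surface_measure i (ref_boundary i))"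
proof (rule finite_measureI)
  let ?\<sigma> = "surface_measure i (ref_boundary i)"
  \<comment> \<open>A common parameter square serves all faces: \<open>x0\<close> needs
    \<open>[-1, 1]\<close>, and the triangle coordinates lie in \<open>[0, 1]\<close>.\<close>
  have le: "(\<integral>\<^sup>+z. 1 * indicator (ref_boundary i) (F z) \<partial>lborel) < \<infinity>"
    if F: "\<And>z. F z \<in> ref_boundary i \<Longrightarrow> z \<in> cbox (- 1, - 1) (1, 1)" for F :: "real \<times> real \<Rightarrow> pt"
  proof -
    have "(\<integral>\<^sup>+z. 1 * indicator (ref_boundary i) (F z) \<partial>lborel)
        \<le> (\<integral>\<^sup>+z. indicator (cbox (- 1, - 1) (1, 1)) (z :: real \<times> real) \<partial>lborel)"
      by (intro nn_integral_mono) (use F in \<open>auto simp: indicator_def\<close>)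
    also have "\<dots> < \<infinity>"
      using emeasure_bounded_finite[OF bounded_cbox[of "(- 1, - 1)" "(1, 1) :: real \<times> real"]] by simp
    finally show ?thesis .
  qed
  have box: "z \<in> cbox (- 1, - 1) (1, 1) \<longleftrightarrow> - 1 \<le> fst z \<and> fst z \<le> 1 \<and> - 1 \<le> snd z \<and> snd z \<le> 1"
    for z :: "real \<times> real"
    by (cases z) (auto simp: mem_box Basis_real_pair)
  have "emeasure ?\<sigma> (space ?\<sigma>) = (\<integral>\<^sup>+x. 1 \<partial>?\<sigma>)" by simp
  also have "\<dots> < \<infinity>"
  proof (cases rule: nat_less_4_cases[OF i])
    case 1
    have "(\<integral>\<^sup>+z. 1 * indicator (ref_boundary 0) (c, z) \<partial>lborel) < \<infinity>" for c
      using le[of "\<lambda>z. (c, z)"] by (auto simp: 1 box mem_ref_boundary closure_ref_prism)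
    then show ?thesis
      using nn_integral_surface_measure(1)[of "\<lambda>_. 1"] by (simp add: 1)
  next
    case 2
    show ?thesis
      using le[of "\<lambda>z. (fst z, 0, snd z)"] nn_integral_surface_measure(2)[of "\<lambda>_. 1"]
      by (simp add: 2 box mem_ref_boundary closure_ref_prism del: One_nat_def)
  next
    case 3
    show ?thesis
      using le[of "\<lambda>z. (fst z, snd z, 0)"] nn_integral_surface_measure(3)[of "\<lambda>_. 1"]
      by (simp add: 3 box mem_ref_boundary closure_ref_prism)
  next
    case 4
    show ?thesis
      using le[of "\<lambda>z. (fst z, snd z, 1 - snd z)"] nn_integral_surface_measure(4)[of "\<lambda>_. 1"]
      by (simp add: 4 box mem_ref_boundary closure_ref_prism ennreal_mult_less_top)
  qed
  finally show "emeasure ?\<sigma> (space ?\<sigma>) \<noteq> \<infinity>" by simp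
qed

text \<open>The Bochner integral of a non-integrable square is 0, and so would be its
  \<open>L2_norm\<close>. Convergence of the norms in \<open>is_trace\<close> is informative only
  because the approximants are known to be square integrable.\<close>

lemma smooth_L2_surface:
  assumes i: "i < 4" and \<phi>: "smooth \<phi>"
  shows "\<phi> \<in> L2 (surface_measure i (ref_boundary i))"
proof -
  let ?\<sigma> = "surface_measure i (ref_boundary i)"
  interpret finite_measure ?\<sigma> by (rule finite_surface_measure[OF i])
  have meas: "\<phi> \<in> borel_measurable ?\<sigma>"
    using measurable_compose[OF surface_measure_borel[OF i] smooth_borel_measurable[OF \<phi>]] .
  have "bounded (\<phi> ` ref_boundary i)"
    by (intro compact_imp_bounded compact_continuous_image smooth_continuous_on \<phi> compact_ref_boundary i)
  then obtain B where B: "\<And>x. x \<in> ref_boundary i \<Longrightarrow> \<bar>\<phi> x\<bar> \<le> B"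
    unfolding bounded_iff by auto
  have "integrable ?\<sigma> (\<lambda>x. (\<phi> x)\<^sup>2)"
  proof (rule integrable_const_bound)
    have "(\<phi> x)\<^sup>2 \<le> B\<^sup>2" if "x \<in> ref_boundary i" for x
      using power_mono[OF B[OF that] abs_ge_zero, of 2] by simp
    then show "AE x in ?\<sigma>. norm ((\<phi> x)\<^sup>2) \<le> B\<^sup>2"
      by (intro AE_I2) (simp add: space_surface_measure[OF i])
  qed (use meas in simp)
  with meas show ?thesis by (simp add: L2_def)
qed

lemma smooth_L2_prism:
  assumes "smooth \<phi>" shows "\<phi> \<in> L2 (lebesgue_on ref_prism)"
proof -
  have R: "ref_prism \<inter> space lebesgue \<in> sets lebesgue" using open_prism[of "- 1" 1] by auto
  have "integrable lborel (\<lambda>x. indicator (closure ref_prism) x *\<^sub>R (\<phi> x)\<^sup>2)"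
    by (intro borel_integrable_compact compact_closure_ref_prism continuous_intros smooth_continuous_on assms)
  then have "integrable lebesgue (\<lambda>x. indicator (closure ref_prism) x *\<^sub>R (\<phi> x)\<^sup>2)"
    by (subst integrable_completion) auto
  from integrable_mult_indicator[OF _ this, of ref_prism] R
  have "integrable lebesgue (\<lambda>x. indicator ref_prism x *\<^sub>R indicator (closure ref_prism) x *\<^sub>R (\<phi> x)\<^sup>2)"
    by simp
  moreover have "(\<lambda>x. indicator ref_prism x *\<^sub>R indicator (closure ref_prism) x *\<^sub>R (\<phi> x)\<^sup>2)
      = (\<lambda>x. indicator ref_prism x *\<^sub>R (\<phi> x)\<^sup>2)"
    using closure_subset[of ref_prism] by (auto simp: indicator_def fun_eq_iff)
  ultimately have "integrable (lebesgue_on ref_prism) (\<lambda>x. (\<phi> x)\<^sup>2)"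
    by (simp add: integrable_restrict_space[OF R])
  then show ?thesis
    using smooth_measurable_lebesgue_on[OF assms] by (simp add: L2_def)
qed

lemma integrable_face_weight_mult:
  assumes i: "i < 4" and f: "f \<in> L2 (surface_measure i (ref_boundary i))"
  shows "integrable (surface_measure i (ref_boundary i)) (\<lambda>x. face_weight i x * (f x)\<^sup>2)"
proof (rule Bochner_Integration.integrable_bound)
  let ?\<sigma> = "surface_measure i (ref_boundary i)"
  show "integrable ?\<sigma> (\<lambda>x. 2 * (f x)\<^sup>2)"
    by (intro integrable_mult_right L2_integrable_square f)
  show "(\<lambda>x. face_weight i x * (f x)\<^sup>2) \<in> borel_measurable ?\<sigma>"
    using measurable_compose[OF surface_measure_borel[OF i] face_weight_borel[OF i]]
    by (intro borel_measurable_times borel_measurable_power L2_borel_measurable[OF f])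
  show "AE x in ?\<sigma>. norm (face_weight i x * (f x)\<^sup>2) \<le> norm (2 * (f x)\<^sup>2)"
    using face_weight_bounds[OF i]
    by (intro AE_I2) (simp add: space_surface_measure[OF i] abs_mult mult_right_mono)
qed

text \<open>The constant 6 is the 3 of \<open>energy\<close> times the 2 of the bound for
  nonnegative integrals; square integrability permits the passage to real integrals.\<close>

lemma trace_inequality:
  assumes i: "i < 4" and d: "smooth d"
  shows "(\<integral>x. face_weight i x * (d x)\<^sup>2 \<partial>surface_measure i (ref_boundary i))
    \<le> 6 * ((L2_norm (lebesgue_on ref_prism) d)\<^sup>2
      + (L2_norm (lebesgue_on ref_prism) (pderivative (face_dir i) d))\<^sup>2)"
proof -
  let ?\<sigma> = "surface_measure i (ref_boundary i)" and ?R = "lebesgue_on ref_prism"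
  let ?I = "\<integral>x. face_weight i x * (d x)\<^sup>2 \<partial>?\<sigma>" and ?E = "\<integral>x. energy (face_dir i) d x \<partial>?R"
  have L2: "d \<in> L2 ?R" "pderivative (face_dir i) d \<in> L2 ?R"
    by (intro smooth_L2_prism smooth_pderivative d face_dir_Basis i)+
  have "ennreal ?I = (\<integral>\<^sup>+x. ennreal (face_weight i x * (d x)\<^sup>2) \<partial>?\<sigma>)"
    using face_weight_bounds[OF i]
    by (intro nn_integral_eq_integral[symmetric] integrable_face_weight_mult smooth_L2_surface i d AE_I2)
      (simp add: space_surface_measure[OF i])
  also have "\<dots> \<le> 2 * (\<integral>\<^sup>+x. ennreal (energy (face_dir i) d x) \<partial>?R)"
    by (rule nn_trace_inequality[OF i d])
  also have "(\<integral>\<^sup>+x. ennreal (energy (face_dir i) d x) \<partial>?R) = ennreal ?E"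
    unfolding energy_def
    by (intro nn_integral_eq_integral integrable_mult_right Bochner_Integration.integrable_add
        L2_integrable_square L2 AE_I2) simp
  also have "2 * ennreal ?E = ennreal (2 * ?E)"
    by (simp add: ennreal_mult' energy_nonneg)
  finally have "?I \<le> 2 * ?E"
    by (subst (asm) ennreal_le_iff) (simp_all add: energy_nonneg)
  also have "?E = 3 * ((L2_norm ?R d)\<^sup>2 + (L2_norm ?R (pderivative (face_dir i) d))\<^sup>2)"
    unfolding energy_def L2_norm_power2
    using L2_integrable_square[OF L2(1)] L2_integrable_square[OF L2(2)] by simp
  finally show ?thesis by simp
qed

text \<open>Extracts from the definition just the two volume limits that the trace inequality uses,
  uniformly in \<open>i\<close>. The conditionals spell out the multi-index of the derivative along
  \<open>face_dir i\<close>: odd \<open>i\<close> stands for the two faces with direction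
  \<open>(0, 1, 0)\<close>.\<close>

lemma is_face_trace_approx:
  assumes i: "i < 4" and tr: "is_face_trace i D \<Gamma> v g"
  obtains \<phi> where "\<And>n. smooth (\<phi> n)"
    "(\<lambda>n. L2_norm (lebesgue_on D) (\<lambda>x. \<phi> n x - weak_D D 0 0 0 v x)) \<longlonglongrightarrow> 0"
    "(\<lambda>n. L2_norm (lebesgue_on D) (\<lambda>x. pderivative (face_dir i) (\<phi> n) x
      - weak_D D (if i = 0 then 1 else 0) (if odd i then 1 else 0) (if i = 2 then 1 else 0) v x)) \<longlonglongrightarrow> 0"
    "(\<lambda>n. L2_norm (surface_measure i \<Gamma>) (\<lambda>x. \<phi> n x - g x)) \<longlonglongrightarrow> 0"
    "g \<in> L2 (surface_measure i \<Gamma>)" "weak_D D 0 0 0 v \<in> L2 (lebesgue_on D)"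
    "weak_D D (if i = 0 then 1 else 0) (if odd i then 1 else 0) (if i = 2 then 1 else 0) v \<in> L2 (lebesgue_on D)"
proof -
  let ?a0 = "if i = 0 then 1 else (0::nat)" and ?a1 = "if odd i then 1 else (0::nat)"
    and ?a2 = "if i = 2 then 1 else (0::nat)"
  obtain rt rs :: nat where tr': "is_trace rt rs D (surface_measure i \<Gamma>) v g" and a: "?a0 \<le> rt" "?a1 + ?a2 \<le> rs"
    using tr by (cases "i = 0") (auto simp: is_face_trace_def)
  then obtain \<phi> where sob: "v \<in> sobolev rt rs D" and g: "g \<in> L2 (surface_measure i \<Gamma>)"
    and sm: "\<And>n. smooth (\<phi> n)"
    and lim: "\<And>a0 a1 a2. a0 \<le> rt \<Longrightarrow> a1 + a2 \<le> rs \<Longrightarrow>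
      (\<lambda>n. L2_norm (lebesgue_on D) (\<lambda>x. partial_D a0 a1 a2 (\<phi> n) x - weak_D D a0 a1 a2 v x)) \<longlonglongrightarrow> 0"
    and limg: "(\<lambda>n. L2_norm (surface_measure i \<Gamma>) (\<lambda>x. \<phi> n x - g x)) \<longlonglongrightarrow> 0"
    unfolding is_trace_def by blast
  have pd: "partial_D 0 0 0 f = f" "partial_D ?a0 ?a1 ?a2 f = pderivative (face_dir i) f" for f
    by (simp add: partial_D_def, cases rule: nat_less_4_cases[OF i]) (simp_all add: partial_D_def face_dir_def)
  show ?thesis
    by (rule that[of \<phi>])
      (use sm limg g lim[of 0 0 0] lim[OF a] weak_D_L2[OF sobolev_weak_D_exists[OF sob a]]
        weak_D_L2[OF sobolev_weak_D_exists[OF sob, of 0 0 0]] in \<open>simp_all only: pd le0 add_0 simp_thms\<close>)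
qed

text \<open>Two approximating sequences have the same limits in the volume, so their differences
  \<open>d n\<close> tend to 0 there together with the derivative along \<open>face_dir i\<close>.
  By the trace inequality they tend to 0 on the face in the weighted norm, which forces the weighted
  norm of \<open>g - g'\<close> to vanish.\<close>

lemma face_trace_unique:
  assumes i: "i < 4"
    and tr: "is_face_trace i ref_prism (ref_boundary i) v g" "is_face_trace i ref_prism (ref_boundary i) v g'"
  shows "AE x in surface_measure i (ref_boundary i). g x = g' x"
proof -
  let ?\<sigma> = "surface_measure i (ref_boundary i)" and ?R = "lebesgue_on ref_prism"
  let ?p = "pderivative (face_dir i)" and ?w = "face_weight i"
  define w0 where "w0 = weak_D ref_prism 0 0 0 v"
  define w1 where "w1 = weak_D ref_prism (if i = 0 then 1 else 0) (if odd i then 1 else 0) (if i = 2 then 1 else 0) v"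
  obtain \<phi> where \<phi>: "\<And>n. smooth (\<phi> n)" "(\<lambda>n. L2_norm ?R (\<lambda>x. \<phi> n x - w0 x)) \<longlonglongrightarrow> 0"
    "(\<lambda>n. L2_norm ?R (\<lambda>x. ?p (\<phi> n) x - w1 x)) \<longlonglongrightarrow> 0" "(\<lambda>n. L2_norm ?\<sigma> (\<lambda>x. \<phi> n x - g x)) \<longlonglongrightarrow> 0"
    "g \<in> L2 ?\<sigma>" and w: "w0 \<in> L2 ?R" "w1 \<in> L2 ?R"
    by (rule is_face_trace_approx[OF i tr(1), folded w0_def w1_def]) (rule that; simp)
  obtain \<psi> where \<psi>: "\<And>n. smooth (\<psi> n)" "(\<lambda>n. L2_norm ?R (\<lambda>x. \<psi> n x - w0 x)) \<longlonglongrightarrow> 0"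
    "(\<lambda>n. L2_norm ?R (\<lambda>x. ?p (\<psi> n) x - w1 x)) \<longlonglongrightarrow> 0" "(\<lambda>n. L2_norm ?\<sigma> (\<lambda>x. \<psi> n x - g' x)) \<longlonglongrightarrow> 0"
    "g' \<in> L2 ?\<sigma>" "w0 \<in> L2 ?R" "w1 \<in> L2 ?R"
    by (rule is_face_trace_approx[OF i tr(2), folded w0_def w1_def]) (rule that; simp)
  note e = face_dir_Basis[OF i]
  define d where "d = (\<lambda>n x. \<phi> n x - \<psi> n x)"
  have sd: "smooth (d n)" for n
    unfolding d_def by (rule smooth_diff[OF \<phi>(1) \<psi>(1)])
  have pd: "?p (d n) = (\<lambda>x. ?p (\<phi> n) x - ?p (\<psi> n) x)" for n
    unfolding d_def by (intro pderivative_diff smooth_differentiable \<phi>(1) \<psi>(1))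
  define a where "a n = 2 * (L2_norm ?R (\<lambda>x. \<phi> n x - w0 x))\<^sup>2 + 2 * (L2_norm ?R (\<lambda>x. \<psi> n x - w0 x))\<^sup>2" for n
  define b where "b n = 2 * (L2_norm ?R (\<lambda>x. ?p (\<phi> n) x - w1 x))\<^sup>2 + 2 * (L2_norm ?R (\<lambda>x. ?p (\<psi> n) x - w1 x))\<^sup>2" for n
  define r where "r n = 2 * (L2_norm ?\<sigma> (\<lambda>x. \<phi> n x - g x))\<^sup>2 + 2 * (L2_norm ?\<sigma> (\<lambda>x. \<psi> n x - g' x))\<^sup>2" for n
  have a: "(L2_norm ?R (d n))\<^sup>2 \<le> a n" for n
    using L2_norm_diff_power2_le[of "\<lambda>x. \<phi> n x - w0 x" ?R "\<lambda>x. \<psi> n x - w0 x"]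
    by (simp add: a_def d_def L2_diff smooth_L2_prism \<phi>(1) \<psi>(1) w)
  have b: "(L2_norm ?R (?p (d n)))\<^sup>2 \<le> b n" for n
    using L2_norm_diff_power2_le[of "\<lambda>x. ?p (\<phi> n) x - w1 x" ?R "\<lambda>x. ?p (\<psi> n) x - w1 x"]
    by (simp add: b_def pd L2_diff smooth_L2_prism smooth_pderivative e \<phi>(1) \<psi>(1) w)
  let ?q = "\<lambda>n x. (\<phi> n x - g x) - (\<psi> n x - g' x)"
  have Lq: "?q n \<in> L2 ?\<sigma>" for n
    by (intro L2_diff smooth_L2_surface i \<phi> \<psi>)
  have r: "(L2_norm ?\<sigma> (?q n))\<^sup>2 \<le> r n" for n
    unfolding r_def by (intro L2_norm_diff_power2_le L2_diff smooth_L2_surface i \<phi> \<psi>)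
  have gg: "(\<lambda>x. g x - g' x) \<in> L2 ?\<sigma>" by (rule L2_diff[OF \<phi>(5) \<psi>(5)])
  let ?I = "\<integral>x. ?w x * (g x - g' x)\<^sup>2 \<partial>?\<sigma>"
  \<comment> \<open>The 6 comes from the trace inequality, the outer 2 from splitting a squared
    difference, and 4 is that 2 times the upper bound 2 of the weight.\<close>
  have bound: "?I \<le> 2 * (6 * (a n + b n)) + 4 * r n" for n
  proof -
    have Ld: "d n \<in> L2 ?\<sigma>" by (rule smooth_L2_surface[OF i sd])
    have "?I \<le> (\<integral>x. 2 * (?w x * (d n x)\<^sup>2) + 4 * (?q n x)\<^sup>2 \<partial>?\<sigma>)"
    proof (rule integral_mono_AE)
      show "integrable ?\<sigma> (\<lambda>x. ?w x * (g x - g' x)\<^sup>2)"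
        by (rule integrable_face_weight_mult[OF i gg])
      show "integrable ?\<sigma> (\<lambda>x. 2 * (?w x * (d n x)\<^sup>2) + 4 * (?q n x)\<^sup>2)"
        by (intro Bochner_Integration.integrable_add integrable_mult_right
            integrable_face_weight_mult[OF i Ld] L2_integrable_square Lq)
      show "AE x in ?\<sigma>. ?w x * (g x - g' x)\<^sup>2 \<le> 2 * (?w x * (d n x)\<^sup>2) + 4 * (?q n x)\<^sup>2"
      proof (rule AE_I2)
        fix x assume "x \<in> space ?\<sigma>"
        then have wx: "0 \<le> ?w x" "?w x \<le> 2"
          using face_weight_bounds[OF i] by (simp_all add: space_surface_measure[OF i])
        \<comment> \<open>The difference of the traces is the difference of the approximants minus
          the difference of the approximation errors on the face.\<close>
        have eq: "g x - g' x = d n x - ?q n x" by (simp add: d_def)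
        have "(g x - g' x)\<^sup>2 \<le> 2 * (d n x)\<^sup>2 + 2 * (?q n x)\<^sup>2"
          unfolding eq by (rule diff_power2_le)
        from mult_left_mono[OF this wx(1)]
        have "?w x * (g x - g' x)\<^sup>2 \<le> 2 * (?w x * (d n x)\<^sup>2) + ?w x * (2 * (?q n x)\<^sup>2)"
          by (simp only: distrib_left mult.left_commute)
        also have "?w x * (2 * (?q n x)\<^sup>2) \<le> 2 * (2 * (?q n x)\<^sup>2)"
          by (intro mult_right_mono wx) simp
        finally show "?w x * (g x - g' x)\<^sup>2 \<le> 2 * (?w x * (d n x)\<^sup>2) + 4 * (?q n x)\<^sup>2"
          by linarith
      qed
    qed
    also have "\<dots> = 2 * (\<integral>x. ?w x * (d n x)\<^sup>2 \<partial>?\<sigma>) + 4 * (L2_norm ?\<sigma> (?q n))\<^sup>2"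
      unfolding L2_norm_power2
      using integrable_face_weight_mult[OF i Ld] L2_integrable_square[OF Lq[of n]]
      by (subst Bochner_Integration.integral_add)
        ((intro integrable_mult_right, assumption)+, simp only: integral_mult_right_zero)
    also have "\<dots> \<le> 2 * (6 * (a n + b n)) + 4 * r n"
    proof -
      have "2 * X + 4 * Q \<le> 2 * (6 * (p + q)) + 4 * s"
        if "X \<le> 6 * (A + B)" "A \<le> p" "B \<le> q" "Q \<le> s" for X A B p q Q s :: real
        using that by (simp add: algebra_simps)
      from this[OF trace_inequality[OF i sd] a b r] show ?thesis .
    qed
    finally show ?thesis .
  qed
  have "(\<lambda>n. 2 * (6 * (a n + b n)) + 4 * r n) \<longlonglongrightarrow> 2 * (6 * ((2 * 0\<^sup>2 + 2 * 0\<^sup>2) + (2 * 0\<^sup>2 + 2 * 0\<^sup>2)))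
      + 4 * (2 * 0\<^sup>2 + 2 * 0\<^sup>2)"
    unfolding a_def b_def r_def by (intro tendsto_intros \<phi> \<psi>)
  then have "?I \<le> 0"
    using bound by (intro LIMSEQ_le_const[of _ 0]) auto
  moreover have nonneg: "AE x in ?\<sigma>. 0 \<le> ?w x * (g x - g' x)\<^sup>2"
    using face_weight_bounds[OF i] by (intro AE_I2) (simp add: space_surface_measure[OF i])
  ultimately have "?I = 0"
    using integral_nonneg_AE[OF nonneg] by linarith
  then have "AE x in ?\<sigma>. ?w x * (g x - g' x)\<^sup>2 = 0"
    using integral_nonneg_eq_0_iff_AE[OF integrable_face_weight_mult[OF i gg] nonneg] by simp
  with AE_face_weight_nonzero[OF i] show ?thesis
    by eventually_elim simp
qed

section \<open>The scaling identities\<close>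

text \<open>The chosen trace on the stretched face, transported and multiplied by \<open>m\<close>,
  is a trace of \<open>v'\<close>, hence equals the chosen one almost everywhere. The factors stay
  on both sides so that no division by \<open>m\<close> occurs.\<close>

lemma face_trace_stretch:
  assumes i: "i < 4" and c: "c > 0"
    and ex: "face_trace_exists i (stretch c b ` ref_prism) (stretch c b ` ref_boundary i) v"
    and v': "v' \<in> L2 (lebesgue_on ref_prism)" "AE x in lebesgue_on ref_prism. v' x = m * v (stretch c b x)"
  shows "face_trace_exists i ref_prism (ref_boundary i) v'"
    and "m\<^sup>2 * (face_norm i (stretch c b ` ref_prism) (stretch c b ` ref_boundary i) v)\<^sup>2
      = face_scale c i * (face_norm i ref_prism (ref_boundary i) v')\<^sup>2"
proof -
  let ?T = "stretch c b" and ?\<sigma> = "surface_measure i (ref_boundary i)"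
  let ?K = "?T ` ref_prism" and ?G = "?T ` ref_boundary i"
  let ?g = "face_trace i ?K ?G v" and ?g' = "face_trace i ref_prism (ref_boundary i) v'"
  have k: "face_scale c i > 0" using c by (simp add: face_scale_def)
  note T = surface_measure_stretch[OF c i ref_boundary_borel[OF i], of b]
  have fin: "finite (fst ` ref_boundary i)" if "i = 0" using that fst_ref_boundary_0 by simp
  note T = T[OF fin]
  have g: "is_face_trace i ?K ?G v ?g"
    using ex unfolding face_trace_exists_def face_trace_def by (rule someI_ex)
  then have gL2: "?g \<in> L2 (surface_measure i ?G)"
    by (auto simp: is_face_trace_def is_trace_def split: if_splits)
  have tr: "is_face_trace i ref_prism (ref_boundary i) v' (\<lambda>x. m * ?g (?T x))"
    using g is_trace_stretch[OF c open_prism k T surface_measure_borel[OF i] _ v', where g = ?g]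
    unfolding is_face_trace_def by (auto split: if_splits)
  then show ex': "face_trace_exists i ref_prism (ref_boundary i) v'"
    unfolding face_trace_exists_def by blast
  have g': "is_face_trace i ref_prism (ref_boundary i) v' ?g'"
    using ex' unfolding face_trace_exists_def face_trace_def by (rule someI_ex)
  then have g'L2: "?g' \<in> L2 ?\<sigma>"
    by (auto simp: is_face_trace_def is_trace_def split: if_splits)
  have mL2: "(\<lambda>x. m * ?g (?T x)) \<in> L2 ?\<sigma>"
    by (rule L2_cmult[OF L2_compose[OF T k gL2]])
  have "L2_norm ?\<sigma> ?g' = L2_norm ?\<sigma> (\<lambda>x. m * ?g (?T x))"
    by (intro L2_norm_cong_AE L2_borel_measurable g'L2 mL2 face_trace_unique[OF i g' tr])
  moreover have "L2_norm (surface_measure i ?G) ?g = sqrt (face_scale c i) * L2_norm ?\<sigma> (\<lambda>x. ?g (?T x))"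
    by (rule L2_norm_compose[OF T k L2_borel_measurable[OF gL2]])
  ultimately show "m\<^sup>2 * (face_norm i ?K ?G v)\<^sup>2
      = face_scale c i * (face_norm i ref_prism (ref_boundary i) v')\<^sup>2"
    using k by (simp add: face_norm_def L2_norm_cmult power_mult_distrib)
qed

text \<open>The exponent \<open>2 * int n - 1\<close> is negative for \<open>n = 0\<close>, hence
  the integer power. The case \<open>k = c\<close> serves the volume and the lateral faces,
  \<open>k = 1\<close> the two faces orthogonal to the first axis.\<close>

lemma powi_scaling:
  fixes c x y k :: real
  assumes "c > 0" and "(c ^ n)\<^sup>2 * x = k * y"
  shows "k = c \<Longrightarrow> x = (1 / c) powi (2 * int n - 1) * y" "k = 1 \<Longrightarrow> x = (1 / c) powi (2 * int n) * y"
proof -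
  have p: "(1 / c) powi (2 * int n) = 1 / (c ^ n)\<^sup>2"
    using power_int_of_nat[of "1 / c" "2 * n"] by (simp add: power_one_over power_even_eq)
  have x: "x = k * y / (c ^ n)\<^sup>2"
    using assms by (simp add: field_simps)
  show "x = (1 / c) powi (2 * int n) * y" if "k = 1"
    using x that by (simp add: p)
  have "(1 / c) powi (2 * int n - 1) = c / (c ^ n)\<^sup>2"
    using assms(1) by (simp add: power_int_diff p)
  then show "x = (1 / c) powi (2 * int n - 1) * y" if "k = c"
    using x that by simp
qed

text \<open>Existence on the reference prism accompanies each identity because \<open>weak_D\<close>
  and \<open>face_trace\<close> are choices, which are meaningful only where a weak derivative or a
  trace exists.\<close>

theorem lemma4p1:
  fixes tn tn1 :: real and st ss :: nat
    and u uh :: "pt \<Rightarrow> real" and K :: "pt set"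
    and \<alpha>0 \<alpha>1 \<alpha>2 :: nat
  assumes "tn < tn1"
    and "K = prism tn tn1"
    and "u \<in> sobolev st ss K"
    and "uh = u \<circ> prism_map tn tn1"
    and "weak_D_exists K \<alpha>0 \<alpha>1 \<alpha>2 u"
  shows "weak_D_exists ref_prism \<alpha>0 \<alpha>1 \<alpha>2 uh \<and>
    (volume_norm K (weak_D K \<alpha>0 \<alpha>1 \<alpha>2 u))\<^sup>2
      = (2 / (tn1 - tn)) powi (2 * int \<alpha>0 - 1)
        * (volume_norm ref_prism (weak_D ref_prism \<alpha>0 \<alpha>1 \<alpha>2 uh))\<^sup>2 \<and>
    (face_trace_exists 0 K (prism_boundary tn tn1 0) (weak_D K \<alpha>0 \<alpha>1 \<alpha>2 u) \<longrightarrow>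
      face_trace_exists 0 ref_prism (ref_boundary 0) (weak_D ref_prism \<alpha>0 \<alpha>1 \<alpha>2 uh) \<and>
      (face_norm 0 K (prism_boundary tn tn1 0) (weak_D K \<alpha>0 \<alpha>1 \<alpha>2 u))\<^sup>2
        = (2 / (tn1 - tn)) powi (2 * int \<alpha>0)
          * (face_norm 0 ref_prism (ref_boundary 0) (weak_D ref_prism \<alpha>0 \<alpha>1 \<alpha>2 uh))\<^sup>2) \<and>
    (\<forall>j \<in> {1, 2, 3}.
      face_trace_exists j K (prism_boundary tn tn1 j) (weak_D K \<alpha>0 \<alpha>1 \<alpha>2 u) \<longrightarrow>
      face_trace_exists j ref_prism (ref_boundary j) (weak_D ref_prism \<alpha>0 \<alpha>1 \<alpha>2 uh) \<and>
      (face_norm j K (prism_boundary tn tn1 j) (weak_D K \<alpha>0 \<alpha>1 \<alpha>2 u))\<^sup>2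
        = (2 / (tn1 - tn)) powi (2 * int \<alpha>0 - 1)
          * (face_norm j ref_prism (ref_boundary j) (weak_D ref_prism \<alpha>0 \<alpha>1 \<alpha>2 uh))\<^sup>2)"
proof -
  define c b where "c = (tn1 - tn) / 2" and "b = (tn + tn1) / 2"
  have c: "c > 0" and ic: "2 / (tn1 - tn) = 1 / c"
    using assms(1) by (simp_all add: c_def)
  have T: "prism_map tn tn1 = stretch c b"
    by (simp add: prism_map_eq_stretch c_def b_def)
  have K: "K = stretch c b ` ref_prism"
    using prism_map_image[OF assms(1)] assms(2) by (simp add: T)
  have G: "prism_boundary tn tn1 i = stretch c b ` ref_boundary i" for i
    by (simp add: prism_boundary_def T)
  have R: "ref_prism \<in> sets lebesgue" using open_prism[of "- 1" 1] by auto
  note TR = lebesgue_on_stretch[OF c R, of b]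
  let ?w = "weak_D K \<alpha>0 \<alpha>1 \<alpha>2 u" and ?w' = "weak_D ref_prism \<alpha>0 \<alpha>1 \<alpha>2 uh"
  have ex: "weak_D_exists (stretch c b ` ref_prism) \<alpha>0 \<alpha>1 \<alpha>2 u"
    using assms(5) by (simp add: K)
  have "u \<in> L2 (lebesgue_on K)" using assms(3) by (simp add: sobolev_def)
  then have uh: "uh \<in> L2 (lebesgue_on ref_prism)"
    using L2_compose[OF TR c] by (simp add: K assms(4) T o_def)
  \<comment> \<open>For the function itself the scalar \<open>m\<close> of the transport is 1; for
    its derivative, on the faces, it will be \<open>c ^ \<alpha>0\<close>.\<close>
  have uh_AE: "AE x in lebesgue_on ref_prism. uh x = 1 * u (stretch c b x)"
    by (simp add: assms(4) T)
  have ex': "weak_D_exists ref_prism \<alpha>0 \<alpha>1 \<alpha>2 uh"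
    by (rule weak_D_stretch(1)[OF c open_prism ex uh uh_AE])
  have w'_AE: "AE x in lebesgue_on ref_prism. ?w' x = c ^ \<alpha>0 * ?w (stretch c b x)"
    using weak_D_stretch(2)[OF c open_prism ex uh uh_AE] by (simp add: K)
  have w: "?w \<in> L2 (lebesgue_on (stretch c b ` ref_prism))"
    using weak_D_L2[OF ex] by (simp add: K)
  have w': "?w' \<in> L2 (lebesgue_on ref_prism)" by (rule weak_D_L2[OF ex'])
  have "L2_norm (lebesgue_on ref_prism) ?w' = c ^ \<alpha>0 * L2_norm (lebesgue_on ref_prism) (\<lambda>x. ?w (stretch c b x))"
    using L2_norm_cong_AE[OF L2_borel_measurable[OF w']
        L2_borel_measurable[OF L2_cmult[OF L2_compose[OF TR c w]]] w'_AE] c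
    by (simp add: L2_norm_cmult)
  moreover have "L2_norm (lebesgue_on K) ?w = sqrt c * L2_norm (lebesgue_on ref_prism) (\<lambda>x. ?w (stretch c b x))"
    using L2_norm_compose[OF TR c L2_borel_measurable[OF w]] by (simp add: K)
  ultimately have vol: "(c ^ \<alpha>0)\<^sup>2 * (volume_norm K ?w)\<^sup>2 = c * (volume_norm ref_prism ?w')\<^sup>2"
    using c by (simp add: volume_norm_def power_mult_distrib)
  have face: "face_trace_exists i ref_prism (ref_boundary i) ?w'"
    "(c ^ \<alpha>0)\<^sup>2 * (face_norm i K (prism_boundary tn tn1 i) ?w)\<^sup>2
      = face_scale c i * (face_norm i ref_prism (ref_boundary i) ?w')\<^sup>2"
    if "i < 4" "face_trace_exists i K (prism_boundary tn tn1 i) ?w" for i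
    \<comment> \<open>The function whose trace is transported is the chosen derivative
      \<open>?w'\<close>, related to \<open>?w\<close> only through the almost everywhere identity
      \<open>w'_AE\<close>.\<close>
    using face_trace_stretch[OF that(1) c _ w' w'_AE] that(2) by (simp_all add: K G)
  have "(face_norm 0 K (prism_boundary tn tn1 0) ?w)\<^sup>2
      = (1 / c) powi (2 * int \<alpha>0) * (face_norm 0 ref_prism (ref_boundary 0) ?w')\<^sup>2"
    if "face_trace_exists 0 K (prism_boundary tn tn1 0) ?w"
    by (rule powi_scaling(2)[OF c face(2)[OF _ that]]) (simp_all add: face_scale_def)
  moreover have "(face_norm j K (prism_boundary tn tn1 j) ?w)\<^sup>2
      = (1 / c) powi (2 * int \<alpha>0 - 1) * (face_norm j ref_prism (ref_boundary j) ?w')\<^sup>2"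
    if "j \<in> {1, 2, 3}" "face_trace_exists j K (prism_boundary tn tn1 j) ?w" for j
    by (rule powi_scaling(1)[OF c face(2)[OF _ that(2)]]) (use that(1) in \<open>auto simp: face_scale_def\<close>)
  moreover have "face_trace_exists j ref_prism (ref_boundary j) ?w'"
    if "j \<in> {1, 2, 3}" "face_trace_exists j K (prism_boundary tn tn1 j) ?w" for j
    using face(1)[OF _ that(2)] that(1) by auto
  ultimately show ?thesis
    unfolding ic using ex' powi_scaling(1)[OF c vol refl] face(1)[of 0] by simp
qed

end
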